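(* Let $K\subset\mathbb{R}$ be a Cantor set. Any finitely generated periodic subgroup of $\mathfrak{diff}^{1+Lip}(K)$ is finite.
   Context: A Cantor set is a (nonempty) compact totally disconnected set each of whose points is an accumulation point. For a Cantor set $K\subset\mathbb{R}$, $\mathfrak{diff}^{1+Lip}(K)$ is the group (under composition) of homeomorphisms $f$ of $K$ such that for every $x\in K$ there exist an open interval $I\subset\mathbb{R}$ containing $x$ and a $C^1$-diffeomorphism $\tilde f:I\to\tilde f(I)\subset\mathbb{R}$ with $\log|\tilde f'|$ Lipschitz continuous on $I$ and $\tilde f_{|I\cap K}=f_{|I\cap K}$. A group is periodic if each of its elements has finite order. *)

theory Defs
  imports "HOL-Analysis.Analysis" "HOL-Algebra.Bij" "HOL-Algebra.Generated_Groups"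
begin

definition Cantor_set :: "'a::topological_space set \<Rightarrow> bool" where
  "Cantor_set K \<longleftrightarrow>
     K \<noteq> {} \<and> compact K \<and> (\<forall>x\<in>K. x islimpt K) \<and>
     (\<forall>C. C \<subseteq> K \<longrightarrow> connected C \<longrightarrow> (\<exists>a. C \<subseteq> {a}))"

text \<open>Used for open intervals \<^term>\<open>I\<close>. Then \<^term>\<open>F ` I\<close> is again an open interval, so
  the two-sided derivatives of the inverse required at its points make sense.\<close>

definition C1_diffeo_on :: "real set \<Rightarrow> (real \<Rightarrow> real) \<Rightarrow> bool" where
  "C1_diffeo_on I F \<longleftrightarrow>
     inj_on F I \<and> F C1_differentiable_on I \<and> inv_into I F C1_differentiable_on (F ` I)"

text \<open>Elements are functions \<^term>\<open>f :: real \<Rightarrow> real\<close> made canonical outside \<^term>\<open>K\<close> by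
  membership in \<^term>\<open>extensional K\<close>, as in \<^const>\<open>BijGroup\<close>; only the values on \<^term>\<open>K\<close>
  matter. The extension \<^term>\<open>F\<close> need not map \<^term>\<open>I - K\<close> outside \<^term>\<open>K\<close>.\<close>

definition diff_1Lip :: "real set \<Rightarrow> (real \<Rightarrow> real) set" where
  "diff_1Lip K =
     {f \<in> extensional K. (\<exists>g. homeomorphism K K f g) \<and>
        (\<forall>x\<in>K. \<exists>I F. open I \<and> is_interval I \<and> x \<in> I \<and> C1_diffeo_on I F \<and>
           (\<exists>L. L-lipschitz_on I (\<lambda>t. ln \<bar>deriv F t\<bar>)) \<and>
           (\<forall>y\<in>I \<inter> K. F y = f y))}"

definition diff_1Lip_group :: "real set \<Rightarrow> (real \<Rightarrow> real) monoid" where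
  "diff_1Lip_group K = BijGroup K\<lparr>carrier := diff_1Lip K\<rparr>"

lemma C1_diffeo_onD:
  assumes "C1_diffeo_on I F" "open I" "is_interval I"
  shows "open (F ` I)" "is_interval (F ` I)" "inj_on F I" "continuous_on I F"
    "continuous_on I (deriv F)"
    "\<And>t. t \<in> I \<Longrightarrow> (F has_real_derivative deriv F t) (at t)"
    "\<And>t. t \<in> I \<Longrightarrow> deriv F t \<noteq> 0"
proof -
  show inj: "inj_on F I" using assms by (simp add: C1_diffeo_on_def)
  obtain D where D: "\<And>t. t \<in> I \<Longrightarrow> (F has_real_derivative D t) (at t)" "continuous_on I D"
    using assms unfolding C1_diffeo_on_def C1_differentiable_on_def
    by (auto simp: has_real_derivative_iff_has_vector_derivative)
  obtain E where E: "\<And>t. t \<in> I \<Longrightarrow> (inv_into I F has_real_derivative E (F t)) (at (F t))"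
    using assms unfolding C1_diffeo_on_def C1_differentiable_on_def
    by (auto simp: has_real_derivative_iff_has_vector_derivative)
  have eq: "deriv F t = D t" if "t \<in> I" for t using D(1)[OF that] by (rule DERIV_imp_deriv)
  show der: "(F has_real_derivative deriv F t) (at t)" if "t \<in> I" for t
    using D(1)[OF that] eq[OF that] by simp
  show "continuous_on I (deriv F)" using D(2) eq by (simp cong: continuous_on_cong)
  show con: "continuous_on I F"
    by (intro continuous_at_imp_continuous_on ballI) (rule DERIV_isCont[OF D(1)])
  show "open (F ` I)"
    by (rule injective_into_1d_imp_open_map_UNIV[OF assms(2) con inj]) simp
  show "is_interval (F ` I)"
    using con assms(3) by (simp add: is_interval_connected_1 connected_continuous_image)
  show "deriv F t \<noteq> 0" if t: "t \<in> I" for t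
  proof
    assume 0: "deriv F t = 0"
    have "((inv_into I F \<circ> F) has_real_derivative E (F t) * deriv F t) (at t)"
      by (rule DERIV_chain[OF E[OF t] der[OF t]])
    then have "((\<lambda>x. x) has_real_derivative E (F t) * deriv F t) (at t)"
      by (rule DERIV_cong_ev[THEN iffD1, rotated -1])
        (use inj in \<open>auto intro!: eventually_mono[OF eventually_nhds_in_open[OF assms(2) t]]\<close>)
    then have "E (F t) * deriv F t = 1" using DERIV_ident DERIV_unique by blast
    with 0 show False by simp
  qed
qed

lemma C1_diffeo_onI:
  assumes "open I" "is_interval I" "continuous_on I D"
    and der: "\<And>t. t \<in> I \<Longrightarrow> (F has_real_derivative D t) (at t)"
    and nz: "\<And>t. t \<in> I \<Longrightarrow> D t \<noteq> 0"
  shows "C1_diffeo_on I F"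
    and "\<And>t. t \<in> I \<Longrightarrow> (inv_into I F has_real_derivative inverse (D t)) (at (F t))"
    and "continuous_on (F ` I) (inv_into I F)"
proof -
  have con: "continuous_on I F"
    by (intro continuous_at_imp_continuous_on ballI) (rule DERIV_isCont[OF der])
  have less: "F a \<noteq> F b" if "a \<in> I" "b \<in> I" "a < b" for a b
  proof
    assume eq: "F a = F b"
    have sub: "{a..b} \<subseteq> I"
      using mem_is_interval_1_I[OF assms(2) that(1,2)] by auto
    have "\<exists>l z. a < z \<and> z < b \<and> DERIV F z :> l \<and> F b - F a = (b - a) * l"
    proof (rule MVT[OF \<open>a < b\<close>])
      show "continuous_on {a..b} F" using con sub by (rule continuous_on_subset)
      show "F differentiable (at z)" if "a < z" "z < b" for z
        using der[of z] sub that by (auto simp: real_differentiable_def subset_iff)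
    qed
    then obtain l z where z: "a < z" "z < b" "DERIV F z :> l" "F b - F a = (b - a) * l" by blast
    have "z \<in> I" using sub z by auto
    then have "l = D z" using der z(3) DERIV_unique by blast
    then show False using z eq nz[OF \<open>z \<in> I\<close>] by simp
  qed
  have inj: "inj_on F I"
    by (rule linorder_inj_onI') (use less in auto)
  show coninv: "continuous_on (F ` I) (inv_into I F)"
  proof (rule continuous_on_inverse_open_map[OF con refl])
    show "inv_into I F (F x) = x" if "x \<in> I" for x using inj that by simp
    show "openin (top_of_set (F ` I)) (F ` U)" if "openin (top_of_set I) U" for U
    proof -
      have "open U" "U \<subseteq> I" using that assms(1) by (auto simp: openin_open_eq)
      then have "open (F ` U)" 
        using injective_into_1d_imp_open_map_UNIV[OF _ con inj] by blast
      then show ?thesis using \<open>U \<subseteq> I\<close> by (simp add: image_mono open_subset)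
    qed
  qed
  show inv: "(inv_into I F has_real_derivative inverse (D t)) (at (F t))" if t: "t \<in> I" for t
  proof -
    have "(inv_into I F has_derivative (*) (inverse (D t))) (at (F t))"
    proof (rule has_derivative_inverse_strong[OF assms(1) t con])
      show "inv_into I F (F x) = x" if "x \<in> I" for x using inj that by simp
      show "(F has_derivative (*) (D t)) (at t)"
        using der[OF t] by (simp add: has_field_derivative_def)
      show "(*) (D t) \<circ> (*) (inverse (D t)) = id" using nz[OF t] by (auto simp: fun_eq_iff)
    qed
    then show ?thesis by (simp add: has_field_derivative_def)
  qed
  have "F C1_differentiable_on I"
    unfolding C1_differentiable_on_def using der assms(3)
    by (auto simp: has_real_derivative_iff_has_vector_derivative)
  moreover have "inv_into I F C1_differentiable_on (F ` I)"
    unfolding C1_differentiable_on_def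
  proof (intro exI conjI ballI)
    show "(inv_into I F has_vector_derivative inverse (D (inv_into I F u))) (at u)"
      if "u \<in> F ` I" for u
      using that inv inj by (auto simp: has_real_derivative_iff_has_vector_derivative)
    have "continuous_on (F ` I) (\<lambda>u. D (inv_into I F u))"
      by (rule continuous_on_compose2[OF assms(3) coninv]) (simp add: inv_into_into subset_iff inj)
    then show "continuous_on (F ` I) (\<lambda>u. inverse (D (inv_into I F u)))"
      by (rule continuous_on_inverse) (simp add: nz inv_into_into)
  qed
  ultimately show "C1_diffeo_on I F" using inj by (simp add: C1_diffeo_on_def)
qed

lemma lipschitz_on_bounded_DERIV:
  fixes F :: "real \<Rightarrow> real"
  assumes "is_interval J" "\<And>t. t \<in> J \<Longrightarrow> (F has_real_derivative D t) (at t)"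
    and "\<And>t. t \<in> J \<Longrightarrow> \<bar>D t\<bar> \<le> C" "0 \<le> C"
  shows "C-lipschitz_on J F"
proof (rule bounded_derivative_imp_lipschitz)
  show "(F has_derivative (*) (D t)) (at t within J)" if "t \<in> J" for t
    using assms(2)[OF that] by (auto simp: has_field_derivative_def intro: has_derivative_at_withinI)
  show "convex J" using assms(1) by (simp add: is_interval_convex_1)
  show "onorm ((*) (D t)) \<le> C" if "t \<in> J" for t
    by (rule onorm_le) (use assms(3)[OF that] in \<open>simp add: abs_mult mult_right_mono\<close>)
qed fact

lemma C1_diffeo_on_small_ball:
  assumes "C1_diffeo_on I F" "open I" "is_interval I" "x \<in> I" "open V" "x \<in> V"
  obtains r c C where "r > 0" "ball x r \<subseteq> I \<inter> V" "c > 0" "C > 0"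
    "\<And>t. t \<in> ball x r \<Longrightarrow> c \<le> \<bar>deriv F t\<bar> \<and> \<bar>deriv F t\<bar> \<le> C"
proof -
  note D = C1_diffeo_onD[OF assms(1-3)]
  let ?d = "\<bar>deriv F x\<bar>"
  have d: "?d > 0" using D(7)[OF assms(4)] by simp
  have "continuous_on I (\<lambda>t. \<bar>deriv F t\<bar>)" using D(5) by (intro continuous_intros)
  then have op: "open ((\<lambda>t. \<bar>deriv F t\<bar>) -` {?d/2<..<2*?d} \<inter> I)"
    using assms(2) by (simp add: continuous_on_open_vimage)
  have "x \<in> ((\<lambda>t. \<bar>deriv F t\<bar>) -` {?d/2<..<2*?d} \<inter> I) \<inter> V" using assms d by auto
  then obtain r where "r > 0" "ball x r \<subseteq> ((\<lambda>t. \<bar>deriv F t\<bar>) -` {?d/2<..<2*?d} \<inter> I) \<inter> V"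
    using op assms(5) by (meson open_Int openE)
  with d show ?thesis
    by (intro that[of r "?d/2" "2*?d"]) (auto simp: subset_iff less_imp_le)
qed

lemma diff_1Lip_subset_Bij: "diff_1Lip K \<subseteq> Bij K"
proof
  fix f assume f: "f \<in> diff_1Lip K"
  then obtain g where g: "homeomorphism K K f g" by (auto simp: diff_1Lip_def)
  have "bij_betw f K K"
    by (rule bij_betw_byWitness[of K g f K]) (use g in \<open>simp_all add: homeomorphism_def\<close>)
  with f show "f \<in> Bij K" by (simp add: Bij_def diff_1Lip_def)
qed

lemma diff_1LipI:
  assumes "f \<in> extensional K" "homeomorphism K K f g"
    and "\<And>x. x \<in> K \<Longrightarrow> \<exists>I F. open I \<and> is_interval I \<and> x \<in> I \<and> C1_diffeo_on I F \<and>
           (\<exists>L. L-lipschitz_on I (\<lambda>t. ln \<bar>deriv F t\<bar>)) \<and>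
           (\<forall>y\<in>I \<inter> K. F y = f y)"
  shows "f \<in> diff_1Lip K"
  using assms(1,3) exI[of "homeomorphism K K f", OF assms(2)] by (simp add: diff_1Lip_def)

lemma id_diff_1Lip: "(\<lambda>x\<in>K. x) \<in> diff_1Lip K"
proof -
  have h: "homeomorphism K K (\<lambda>x\<in>K. x) (\<lambda>x. x)"
    by (auto simp: homeomorphism_def)
  have C1: "C1_diffeo_on UNIV (\<lambda>x. x)"
    by (rule C1_diffeo_onI[where D="\<lambda>_. 1"]) auto
  have lip: "0-lipschitz_on UNIV (\<lambda>t::real. ln \<bar>deriv (\<lambda>x. x) t\<bar>)"
    by (rule lipschitz_onI) simp_all
  have "\<exists>I F. open I \<and> is_interval I \<and> x \<in> I \<and> C1_diffeo_on I F \<and>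
      (\<exists>L. L-lipschitz_on I (\<lambda>t. ln \<bar>deriv F t\<bar>)) \<and>
      (\<forall>y\<in>I \<inter> K. F y = (\<lambda>x\<in>K. x) y)" for x
    using C1 lip by (intro exI[of _ UNIV] exI[of _ "\<lambda>x. x"] conjI exI[of _ "0::real"]) simp_all
  then show ?thesis by (rule diff_1LipI[OF restrict_extensional h])
qed

lemma compose_diff_1Lip:
  assumes g: "g \<in> diff_1Lip K" and f: "f \<in> diff_1Lip K"
  shows "compose K g f \<in> diff_1Lip K"
proof -
  obtain f' g' where hf: "homeomorphism K K f f'" and hg: "homeomorphism K K g g'"
    using f g by (auto simp: diff_1Lip_def)
  have "homeomorphism K K (g \<circ> f) (f' \<circ> g')" by (rule homeomorphism_compose[OF hf hg])
  then have h: "homeomorphism K K (compose K g f) (f' \<circ> g')"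
    by (rule homeomorphism_cong) (auto simp: compose_def)
  have "\<exists>I H. open I \<and> is_interval I \<and> x \<in> I \<and> C1_diffeo_on I H \<and>
           (\<exists>L. L-lipschitz_on I (\<lambda>t. ln \<bar>deriv H t\<bar>)) \<and>
           (\<forall>y\<in>I \<inter> K. H y = compose K g f y)" if x: "x \<in> K" for x
  proof -
    obtain I F L where F: "open I" "is_interval I" "x \<in> I" "C1_diffeo_on I F"
      "L-lipschitz_on I (\<lambda>t. ln \<bar>deriv F t\<bar>)" "\<And>y. y \<in> I \<Longrightarrow> y \<in> K \<Longrightarrow> F y = f y"
      using f x unfolding diff_1Lip_def by blast
    have fx: "f x \<in> K" using hf x by (auto simp: homeomorphism_def)
    obtain J G M where G: "open J" "is_interval J" "f x \<in> J" "C1_diffeo_on J G"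
      "M-lipschitz_on J (\<lambda>t. ln \<bar>deriv G t\<bar>)" "\<And>y. y \<in> J \<Longrightarrow> y \<in> K \<Longrightarrow> G y = g y"
      using g fx unfolding diff_1Lip_def by blast
    note DF = C1_diffeo_onD[OF F(4,1,2)] and DG = C1_diffeo_onD[OF G(4,1,2)]
    have op: "open (F -` J \<inter> I)" using DF(4) F(1) G(1) by (simp add: continuous_on_open_vimage)
    have "x \<in> F -` J \<inter> I" using F G x by simp
    then obtain r c C where r: "r > 0" "ball x r \<subseteq> I \<inter> (F -` J \<inter> I)" "C > 0"
       "\<And>t. t \<in> ball x r \<Longrightarrow> \<bar>deriv F t\<bar> \<le> C"
      using C1_diffeo_on_small_ball[OF F(4,1,2,3) op] by metis
    let ?B = "ball x r"
    have BI: "t \<in> I" "F t \<in> J" if "t \<in> ?B" for t using r that by auto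
    have iB: "is_interval ?B" by (simp add: is_interval_ball_real)
    have lipF: "C-lipschitz_on ?B F"
      by (rule lipschitz_on_bounded_DERIV[OF iB DF(6)]) (use r BI in auto)
    let ?D = "\<lambda>t. deriv G (F t) * deriv F t"
    have der: "((\<lambda>t. G (F t)) has_real_derivative ?D t) (at t)" if "t \<in> ?B" for t
      by (rule DERIV_chain2[OF DG(6) DF(6)]) (use BI that in auto)
    have cF: "continuous_on ?B F" "continuous_on ?B (deriv F)"
      using DF(4,5) BI by (auto intro: continuous_on_subset)
    have cD: "continuous_on ?B ?D"
      by (intro continuous_on_mult continuous_on_compose2[OF DG(5) cF(1)] cF) (use BI in auto)
    have C1: "C1_diffeo_on ?B (\<lambda>t. G (F t))"
      by (rule C1_diffeo_onI[OF _ iB cD der]) (use DF(7) DG(7) BI in auto)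
    have ln: "ln \<bar>deriv (\<lambda>t. G (F t)) t\<bar> = ln \<bar>deriv G (F t)\<bar> + ln \<bar>deriv F t\<bar>" if "t \<in> ?B" for t
      using DERIV_imp_deriv[OF der[OF that]] DF(7) DG(7) BI[OF that] by (simp add: abs_mult ln_mult)
    have "(M * C)-lipschitz_on ?B (\<lambda>t. ln \<bar>deriv G (F t)\<bar>)"
      by (rule lipschitz_on_compose2[OF lipF]) (use G(5) BI in \<open>auto intro: lipschitz_on_subset\<close>)
    moreover have "L-lipschitz_on ?B (\<lambda>t. ln \<bar>deriv F t\<bar>)"
      using F(5) BI by (auto intro: lipschitz_on_subset)
    ultimately have "(M * C + L)-lipschitz_on ?B (\<lambda>t. ln \<bar>deriv G (F t)\<bar> + ln \<bar>deriv F t\<bar>)"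
      by (rule lipschitz_on_add)
    then have lip: "(M * C + L)-lipschitz_on ?B (\<lambda>t. ln \<bar>deriv (\<lambda>t. G (F t)) t\<bar>)"
      by (rule lipschitz_on_transform) (simp add: ln)
    have "\<forall>y\<in>?B \<inter> K. G (F y) = compose K g f y"
    proof
      fix y assume y: "y \<in> ?B \<inter> K"
      have "f y \<in> K" using hf y by (auto simp: homeomorphism_def)
      moreover have "F y = f y" using F(6) BI y by simp
      moreover have "f y \<in> J" using BI(2)[of y] y \<open>F y = f y\<close> by simp
      ultimately show "G (F y) = compose K g f y" using G(6) y by (simp add: compose_def)
    qed
    with C1 lip iB r(1) show ?thesis
      by (intro exI[of _ ?B] exI[of _ "\<lambda>t. G (F t)"] conjI exI[of _ "M * C + L"]) simp_all
  qed
  then show ?thesis by (rule diff_1LipI[OF compose_extensional h])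
qed

lemma inv_diff_1Lip:
  assumes f: "f \<in> diff_1Lip K"
  shows "restrict (inv_into K f) K \<in> diff_1Lip K"
proof -
  obtain f' where hf: "homeomorphism K K f f'" using f by (auto simp: diff_1Lip_def)
  have injf: "inj_on f K"
    using f diff_1Lip_subset_Bij by (auto simp: Bij_def bij_betw_def)
  have f': "restrict (inv_into K f) K y = f' y" if "y \<in> K" for y
  proof -
    have "f' y \<in> K" "f (f' y) = y" using hf that by (auto simp: homeomorphism_def)
    then have "inv_into K f y = f' y" using injf inv_into_f_eq by fastforce
    then show ?thesis using that by simp
  qed
  have "homeomorphism K K f' f" using hf by (rule homeomorphism_symD)
  then have h: "homeomorphism K K (restrict (inv_into K f) K) f"
    by (rule homeomorphism_cong[OF _ refl refl]) (simp_all only: f')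
  have "\<exists>J G. open J \<and> is_interval J \<and> y \<in> J \<and> C1_diffeo_on J G \<and>
           (\<exists>L. L-lipschitz_on J (\<lambda>t. ln \<bar>deriv G t\<bar>)) \<and>
           (\<forall>u\<in>J \<inter> K. G u = restrict (inv_into K f) K u)" if y: "y \<in> K" for y
  proof -
    define x where "x = f' y"
    have x: "x \<in> K" "f x = y" using hf y by (auto simp: homeomorphism_def x_def)
    obtain I F L where F: "open I" "is_interval I" "x \<in> I" "C1_diffeo_on I F"
      "L-lipschitz_on I (\<lambda>t. ln \<bar>deriv F t\<bar>)" "\<And>u. u \<in> I \<Longrightarrow> u \<in> K \<Longrightarrow> F u = f u"
      using f x unfolding diff_1Lip_def by blast
    note DF = C1_diffeo_onD[OF F(4,1,2)]
    obtain r c C where r: "r > 0" "ball x r \<subseteq> I \<inter> UNIV" "c > 0"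
       "\<And>t. t \<in> ball x r \<Longrightarrow> c \<le> \<bar>deriv F t\<bar>"
      using C1_diffeo_on_small_ball[OF F(4,1,2,3), of UNIV] by (metis open_UNIV UNIV_I)
    let ?B = "ball x r"
    have iB: "is_interval ?B" by (simp add: is_interval_ball_real)
    have BI: "t \<in> I" if "t \<in> ?B" for t using r that by auto
    have cD: "continuous_on ?B (deriv F)" using DF(5) BI by (auto intro: continuous_on_subset)
    define G where "G = inv_into ?B F"
    have C1F: "C1_diffeo_on ?B F" and derG: "\<And>t. t \<in> ?B \<Longrightarrow> (G has_real_derivative inverse (deriv F t)) (at (F t))"
       and cG: "continuous_on (F ` ?B) G"
      unfolding G_def by (rule C1_diffeo_onI[OF _ iB cD]; use DF BI in simp)+
    note DB = C1_diffeo_onD[OF C1F open_ball iB]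
    have GF: "G (F t) = t" if "t \<in> ?B" for t using DB(3) that by (simp add: G_def)
    \<comment> \<open>points of \<^term>\<open>K\<close> near \<^term>\<open>y\<close> come from points of \<^term>\<open>K\<close> near \<^term>\<open>x\<close>\<close>
    have "continuous_on K f'" using hf by (simp add: homeomorphism_def)
    then obtain W where W: "open W" "W \<inter> K = f' -` ?B \<inter> K"
      by (metis continuous_on_open_invariant open_ball)
    have yW: "y \<in> W" using W(2) y r(1) by (auto simp: x_def)
    have yF: "y \<in> F ` ?B" using F(6)[OF F(3) x(1)] x(2) r(1)
      by (intro image_eqI[of _ _ x]) simp_all
    obtain e where e: "e > 0" "ball y e \<subseteq> F ` ?B \<inter> W"
      using DB(1) W(1) yW yF by (meson IntI open_Int openE)
    let ?J = "ball y e"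
    have iJ: "is_interval ?J" by (simp add: is_interval_ball_real)
    have GJ: "G u \<in> ?B" "F (G u) = u" if "u \<in> ?J" for u
      using e that GF by (auto simp: subset_iff)
    have der: "(G has_real_derivative inverse (deriv F (G u))) (at u)" if "u \<in> ?J" for u
      using derG[OF GJ(1)[OF that]] GJ(2)[OF that] by simp
    have cGJ: "continuous_on ?J G" using cG e by (auto intro: continuous_on_subset)
    have "continuous_on ?J (\<lambda>u. deriv F (G u))"
      by (rule continuous_on_compose2[OF cD cGJ]) (use GJ in auto)
    then have cI: "continuous_on ?J (\<lambda>u. inverse (deriv F (G u)))"
      by (rule continuous_on_inverse) (use DB(7) GJ in auto)
    have C1: "C1_diffeo_on ?J G"
      by (rule C1_diffeo_onI[OF _ iJ cI der]) (use DB(7) GJ in auto)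
    have lipG: "(inverse c)-lipschitz_on ?J G"
    proof (rule lipschitz_on_bounded_DERIV[OF iJ der])
      show "\<bar>inverse (deriv F (G u))\<bar> \<le> inverse c" if "u \<in> ?J" for u
        using r(3) r(4)[OF GJ(1)[OF that]] by (simp add: abs_inverse le_imp_inverse_le)
    qed (use r in auto)
    have ln: "ln \<bar>deriv G u\<bar> = - ln \<bar>deriv F (G u)\<bar>" if "u \<in> ?J" for u
      using DERIV_imp_deriv[OF der[OF that]] DB(7) GJ[OF that] by (simp add: abs_inverse ln_inverse)
    have "(L * inverse c)-lipschitz_on ?J (\<lambda>u. ln \<bar>deriv F (G u)\<bar>)"
      by (rule lipschitz_on_compose2[OF lipG]) (use F(5) BI GJ in \<open>auto intro!: lipschitz_on_subset[OF F(5)]\<close>)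
    then have "(L * inverse c)-lipschitz_on ?J (\<lambda>u. - ln \<bar>deriv F (G u)\<bar>)"
      by (simp add: lipschitz_on_def dist_real_def abs_minus_commute)
    then have lip: "(L * inverse c)-lipschitz_on ?J (\<lambda>u. ln \<bar>deriv G u\<bar>)"
      by (rule lipschitz_on_transform) (simp add: ln)
    have "\<forall>u\<in>?J \<inter> K. G u = restrict (inv_into K f) K u"
    proof
      fix u assume u: "u \<in> ?J \<inter> K"
      then have "u \<in> W \<inter> K" using e(2) by blast
      then have "f' u \<in> ?B" unfolding W(2) by simp
      moreover have "f' u \<in> K" "f (f' u) = u" using hf u by (auto simp: homeomorphism_def)
      ultimately have fu: "f' u \<in> ?B" "f' u \<in> K" "f (f' u) = u" by blast+
      then have "F (f' u) = u" using F(6) BI by simp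
      then have "G u = f' u" using GF[OF fu(1)] by simp
      then show "G u = restrict (inv_into K f) K u" using f' u by simp
    qed
    with C1 lip iJ e(1) show ?thesis
      by (intro exI[of _ ?J] exI[of _ G] conjI exI[of _ "L * inverse c"]) simp_all
  qed
  then show ?thesis by (rule diff_1LipI[OF restrict_extensional h])
qed

lemma subgroup_diff_1Lip: "subgroup (diff_1Lip K) (BijGroup K)"
proof
  show "diff_1Lip K \<subseteq> carrier (BijGroup K)"
    using diff_1Lip_subset_Bij by (simp add: BijGroup_def)
  show "g \<otimes>\<^bsub>BijGroup K\<^esub> f \<in> diff_1Lip K" if "g \<in> diff_1Lip K" "f \<in> diff_1Lip K" for g f
    using that compose_diff_1Lip diff_1Lip_subset_Bij by (auto simp: BijGroup_def subset_iff)
  show "\<one>\<^bsub>BijGroup K\<^esub> \<in> diff_1Lip K" by (simp add: BijGroup_def id_diff_1Lip)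
  show "inv\<^bsub>BijGroup K\<^esub> f \<in> diff_1Lip K" if "f \<in> diff_1Lip K" for f
    using that inv_diff_1Lip diff_1Lip_subset_Bij by (simp add: inv_BijGroup subset_iff)
qed

lemma group_diff_1Lip_group: "group (diff_1Lip_group K)"
  unfolding diff_1Lip_group_def
  by (rule group.subgroup_imp_group[OF group_BijGroup subgroup_diff_1Lip])

end

theory Submission
  imports Defs
begin

text \<open>All orbits of the group are finite, and finite orbits force finiteness of the group.

  If the orbit of \<open>p\<close> is finite, there are only finitely many germs at \<open>p\<close> of group elements: two
  elements with the same value and the same local orientation at \<open>p\<close> differ by an increasing germ of
  finite order, which is trivial. By finite generation the group then has finitely many restrictions
  to a neighbourhood of \<open>p\<close>, and a compactness argument finishes the proof.

  An infinite orbit is excluded by a Sacksteder argument. Choose a compact invariant set \<open>L\<close> whose maximum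
  \<open>x\<close> has infinite orbit and lies in every orbit closure of \<open>L\<close>. Points of the orbit of \<open>x\<close> bound gaps of \<open>L\<close>.
  Along a geodesic of the orbit these gaps are distinct, so their total length is finite and the distortion of
  the words read along the geodesic is bounded. Hence these words contract a fixed neighbourhood
  of a point of the orbit, and composing with an element that returns close to this point gives a
  contraction of the neighbourhood into itself, which cannot have finite order.\<close>

section \<open>Total length of the gaps of a bounded set\<close>

lemma sum_gap_lengths_aux:
  fixes P :: "real set"
  assumes "finite P" "a \<le> b" "\<And>p. p \<in> P \<Longrightarrow> a \<le> p \<and> q p \<le> b"
    "\<And>p p'. p \<in> P \<Longrightarrow> p' \<in> P \<Longrightarrow> p < p' \<Longrightarrow> q p \<le> p'"
  shows "(\<Sum>p\<in>P. q p - p) \<le> b - a"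
  using assms
proof (induction P arbitrary: b rule: finite_linorder_max_induct)
  case empty
  then show ?case by simp
next
  case (insert m P)
  have "(\<Sum>p\<in>P. q p - p) \<le> m - a"
    by (rule insert.IH) (use insert in auto)
  moreover have "q m \<le> b" "m \<notin> P" using insert.hyps insert.prems(2)[of m] by auto
  ultimately show ?case using insert.hyps(1) by simp
qed

text \<open>The first argument is the endpoint being followed. The second may lie on either side of
  it, since generators may reverse the orientation.\<close>

definition gap :: "real set \<Rightarrow> real \<Rightarrow> real \<Rightarrow> bool" where
  "gap L p q \<longleftrightarrow> p \<in> L \<and> q \<in> L \<and> p \<noteq> q \<and> (\<forall>w\<in>L. \<not> (min p q < w \<and> w < max p q))"

text \<open>The gaps to the right of their tracked endpoint do not overlap, and neither do those to
  its left, so each family has total length at most \<open>b - a\<close>. The factor 2 is real: a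
  gap may be listed once from each end.\<close>

lemma sum_gap_lengths:
  assumes L: "L \<subseteq> {a..b}" and ab: "a \<le> b" and fin: "finite J" and inj: "inj_on p J"
    and gap: "\<And>j. j \<in> J \<Longrightarrow> gap L (p j) (q j)"
  shows "(\<Sum>j\<in>J. \<bar>p j - q j\<bar>) \<le> 2 * (b - a)"
proof -
  define J1 where "J1 = {j\<in>J. p j < q j}"
  define J2 where "J2 = {j\<in>J. q j < p j}"
  have J: "J = J1 \<union> J2" "J1 \<inter> J2 = {}" "finite J1" "finite J2"
    using gap fin by (auto simp: J1_def J2_def gap_def neq_iff)
  have i1: "inj_on p J1" and i2: "inj_on (\<lambda>j. - p j) J2"
    using inj by (auto simp: inj_on_def J1_def J2_def)
  have gL: "p j \<in> L" "q j \<in> L" "p j \<in> {a..b}" "q j \<in> {a..b}" if "j \<in> J" for j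
    using gap[OF that] L by (auto simp: gap_def)
  have "(\<Sum>j\<in>J1. q j - p j) = (\<Sum>x\<in>p ` J1. q (the_inv_into J1 p x) - x)"
    by (subst sum.reindex[OF i1]) (auto simp: the_inv_into_f_f[OF i1] intro!: sum.cong)
  also have "\<dots> \<le> b - a"
  proof (rule sum_gap_lengths_aux[OF _ ab])
    show "q (the_inv_into J1 p x) \<le> y" if "x \<in> p ` J1" "y \<in> p ` J1" "x < y" for x y
    proof -
      from that obtain j k where jk: "j \<in> J1" "k \<in> J1" "x = p j" "y = p k" by auto
      have "j \<in> J" "k \<in> J" "p j < q j" using jk by (auto simp: J1_def)
      then have "\<not> (p j < p k \<and> p k < q j)" using gap[of j] gL(1)[of k] by (auto simp: gap_def)
      then show ?thesis using that(3) jk by (simp add: the_inv_into_f_f[OF i1 jk(1)])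
    qed
    show "a \<le> x \<and> q (the_inv_into J1 p x) \<le> b" if "x \<in> p ` J1" for x
      using that gL J(1) by (auto simp: the_inv_into_f_f[OF i1])
  qed (use J in auto)
  finally have 1: "(\<Sum>j\<in>J1. \<bar>p j - q j\<bar>) \<le> b - a"
    by (subst sum.cong[OF refl, where h="\<lambda>j. q j - p j"]) (auto simp: J1_def)
  \<comment> \<open>Reflection turns gaps to the left into gaps to the right.\<close>
  let ?p = "\<lambda>j. - p j"
  have "(\<Sum>j\<in>J2. - q j - ?p j) = (\<Sum>x\<in>?p ` J2. - q (the_inv_into J2 ?p x) - x)"
    by (subst sum.reindex[OF i2]) (auto simp: the_inv_into_f_f[OF i2] intro!: sum.cong)
  also have "\<dots> \<le> - a - - b"
  proof (rule sum_gap_lengths_aux)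
    show "- q (the_inv_into J2 ?p x) \<le> y" if "x \<in> ?p ` J2" "y \<in> ?p ` J2" "x < y" for x y
    proof -
      from that obtain j k where jk: "j \<in> J2" "k \<in> J2" "x = - p j" "y = - p k" by auto
      have "j \<in> J" "k \<in> J" "q j < p j" using jk by (auto simp: J2_def)
      then have "\<not> (q j < p k \<and> p k < p j)" using gap[of j] gL(1)[of k] by (auto simp: gap_def)
      then show ?thesis using that(3) jk by (simp add: the_inv_into_f_f[OF i2 jk(1)])
    qed
    show "- b \<le> x \<and> - q (the_inv_into J2 ?p x) \<le> - a" if "x \<in> ?p ` J2" for x
      using that gL J(1) by (auto simp: the_inv_into_f_f[OF i2])
  qed (use J ab in auto)
  finally have 2: "(\<Sum>j\<in>J2. \<bar>p j - q j\<bar>) \<le> b - a"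
    by (subst sum.cong[OF refl, where h="\<lambda>j. - q j - - p j"]) (auto simp: J2_def)
  show ?thesis
    unfolding J(1) sum.union_disjoint[OF J(3,4,2)] using 1 2 by argo
qed

text \<open>Choosing one long gap for each of n endpoints gives total length at least n times
  \<open>e\<close>, while \<open>sum_gap_lengths\<close> bounds the total; hence n is
  bounded.\<close>

lemma finite_long_gaps:
  assumes "bounded L" "e > 0"
  shows "finite {p. \<exists>q. gap L p q \<and> e \<le> \<bar>p - q\<bar>}"
proof -
  obtain c where c: "c > 0" "\<And>x. x \<in> L \<Longrightarrow> \<bar>x\<bar> \<le> c" using assms(1) by (auto simp: bounded_pos)
  have L: "L \<subseteq> {- c..c}" using c(2) by (fastforce simp: abs_le_iff)
  have "card P \<le> nat \<lfloor>4 * c / e\<rfloor>" if P: "P \<subseteq> {p. \<exists>q. gap L p q \<and> e \<le> \<bar>p - q\<bar>}" "finite P" for P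
  proof -
    obtain q where q: "\<And>p. p \<in> P \<Longrightarrow> gap L p (q p) \<and> e \<le> \<bar>p - q p\<bar>"
      using P by (simp add: subset_iff) metis
    have "real (card P) * e \<le> (\<Sum>p\<in>P. \<bar>p - q p\<bar>)"
      using q sum_mono[of P "\<lambda>_. e" "\<lambda>p. \<bar>p - q p\<bar>"] by simp
    also have "\<dots> \<le> 2 * (c - - c)"
      by (rule sum_gap_lengths[OF L]) (use c P q in auto)
    finally have "real (card P) \<le> 4 * c / e" using assms by (simp add: field_simps)
    then show ?thesis by linarith
  qed
  then show ?thesis using finite_if_finite_subsets_card_bdd by blast
qed

section \<open>Bounded distortion\<close>

text \<open>The inequality compares the difference quotients of \<open>f\<close> from
  \<open>a\<close> to \<open>b\<close> and from \<open>a\<close> to \<open>c\<close>, cleared of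
  denominators so that \<open>b\<close> or \<open>c\<close> may equal \<open>a\<close>. It keeps, on
  points of \<open>K\<close> alone, what a Lipschitz bound on the logarithm of the derivative of an
  extension provides, and replaces derivatives in the study of the action.\<close>

definition bounded_distortion :: "real set \<Rightarrow> (real \<Rightarrow> real) \<Rightarrow> real \<Rightarrow> real \<Rightarrow> bool" where
  "bounded_distortion K f d M \<longleftrightarrow> (\<forall>a\<in>K.
     (strict_mono_on (K \<inter> ball a d) f \<or> strict_antimono_on (K \<inter> ball a d) f) \<and>
     (\<forall>b\<in>K \<inter> ball a d. \<forall>c\<in>K \<inter> ball a d.
        \<bar>f a - f b\<bar> * \<bar>a - c\<bar> \<le> exp (M * (\<bar>a - b\<bar> + \<bar>a - c\<bar>)) * (\<bar>f a - f c\<bar> * \<bar>a - b\<bar>)))"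

lemma bounded_distortion_mono:
  assumes "bounded_distortion K f d M" "d' \<le> d" "M \<le> M'"
  shows "bounded_distortion K f d' M'"
  unfolding bounded_distortion_def
proof (intro ballI conjI)
  fix a assume a: "a \<in> K"
  have sub: "K \<inter> ball a d' \<subseteq> K \<inter> ball a d" using assms(2) by auto
  show "strict_mono_on (K \<inter> ball a d') f \<or> strict_antimono_on (K \<inter> ball a d') f"
    using assms(1) a sub unfolding bounded_distortion_def by (meson monotone_on_subset)
  fix b c assume bc: "b \<in> K \<inter> ball a d'" "c \<in> K \<inter> ball a d'"
  have "\<bar>f a - f b\<bar> * \<bar>a - c\<bar> \<le> exp (M * (\<bar>a - b\<bar> + \<bar>a - c\<bar>)) * (\<bar>f a - f c\<bar> * \<bar>a - b\<bar>)"
    using assms(1) a bc sub unfolding bounded_distortion_def by blast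
  also have "\<dots> \<le> exp (M' * (\<bar>a - b\<bar> + \<bar>a - c\<bar>)) * (\<bar>f a - f c\<bar> * \<bar>a - b\<bar>)"
    using assms(3) by (intro mult_right_mono) (auto intro!: mult_right_mono)
  finally show "\<bar>f a - f b\<bar> * \<bar>a - c\<bar> \<le> exp (M' * (\<bar>a - b\<bar> + \<bar>a - c\<bar>)) * (\<bar>f a - f c\<bar> * \<bar>a - b\<bar>)" .
qed

text \<open>By the mean value theorem both increments are governed by derivatives at points no
  farther from \<open>a\<close> than \<open>b\<close> and \<open>c\<close> are; the Lipschitz bound
  compares the logarithms of these two derivatives.\<close>

lemma C1_diffeo_on_distortion:
  assumes C1: "C1_diffeo_on I F" "open I" "is_interval I"
    and lip: "M-lipschitz_on I (\<lambda>t. ln \<bar>deriv F t\<bar>)"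
    and abc: "a \<in> I" "b \<in> I" "c \<in> I"
  shows "\<bar>F a - F b\<bar> * \<bar>a - c\<bar> \<le> exp (M * (\<bar>a - b\<bar> + \<bar>a - c\<bar>)) * (\<bar>F a - F c\<bar> * \<bar>a - b\<bar>)"
proof -
  note D = C1_diffeo_onD[OF C1]
  have mv: "\<exists>z\<in>I. \<bar>a - z\<bar> \<le> \<bar>a - u\<bar> \<and> \<bar>F a - F u\<bar> = \<bar>deriv F z\<bar> * \<bar>a - u\<bar>" if u: "u \<in> I" for u
  proof -
    have *: "\<exists>z\<in>I. z \<in> {v..w} \<and> F w - F v = (w - v) * deriv F z" if vw: "v < w" "v \<in> I" "w \<in> I" for v w
    proof -
      have sub: "{v..w} \<subseteq> I" using mem_is_interval_1_I[OF C1(3) vw(2,3)] by auto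
      have "\<exists>z. v < z \<and> z < w \<and> F w - F v = (w - v) * deriv F z"
        by (rule MVT2[OF vw(1)]) (use sub D(6) in auto)
      then obtain z where "v < z" "z < w" "F w - F v = (w - v) * deriv F z" by blast
      with sub show ?thesis by (intro bexI[of _ z]) auto
    qed
    show ?thesis
    proof (cases a u rule: linorder_cases)
      case less
      from *[OF this abc(1) u] obtain z where z: "z \<in> I" "z \<in> {a..u}" "F u - F a = (u - a) * deriv F z" by blast
      have "\<bar>F a - F u\<bar> = \<bar>deriv F z\<bar> * \<bar>a - u\<bar>"
        by (metis z(3) abs_minus_commute abs_mult mult.commute)
      with z show ?thesis by (intro bexI[of _ z]) auto
    next
      case greater
      from *[OF this u abc(1)] obtain z where z: "z \<in> I" "z \<in> {u..a}" "F a - F u = (a - u) * deriv F z" by blast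
      have "\<bar>F a - F u\<bar> = \<bar>deriv F z\<bar> * \<bar>a - u\<bar>"
        by (metis z(3) abs_mult mult.commute)
      with z show ?thesis by (intro bexI[of _ z]) auto
    qed (use abc in auto)
  qed
  obtain z where z: "z \<in> I" "\<bar>a - z\<bar> \<le> \<bar>a - b\<bar>" "\<bar>F a - F b\<bar> = \<bar>deriv F z\<bar> * \<bar>a - b\<bar>"
    using mv[OF abc(2)] by blast
  obtain w where w: "w \<in> I" "\<bar>a - w\<bar> \<le> \<bar>a - c\<bar>" "\<bar>F a - F c\<bar> = \<bar>deriv F w\<bar> * \<bar>a - c\<bar>"
    using mv[OF abc(3)] by blast
  have M: "M \<ge> 0" using lip by (rule lipschitz_on_nonneg)
  have "ln \<bar>deriv F z\<bar> - ln \<bar>deriv F w\<bar> \<le> M * \<bar>z - w\<bar>"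
    using lipschitz_onD[OF lip z(1) w(1)] by (simp add: dist_real_def)
  also have "\<dots> \<le> M * (\<bar>a - b\<bar> + \<bar>a - c\<bar>)"
    using z(2) w(2) M by (intro mult_left_mono) linarith+
  finally have "ln \<bar>deriv F z\<bar> \<le> M * (\<bar>a - b\<bar> + \<bar>a - c\<bar>) + ln \<bar>deriv F w\<bar>" by simp
  then have "exp (ln \<bar>deriv F z\<bar>) \<le> exp (M * (\<bar>a - b\<bar> + \<bar>a - c\<bar>)) * exp (ln \<bar>deriv F w\<bar>)"
    by (simp flip: exp_add)
  then have "\<bar>deriv F z\<bar> \<le> exp (M * (\<bar>a - b\<bar> + \<bar>a - c\<bar>)) * \<bar>deriv F w\<bar>"
    using D(7) z(1) w(1) by simp
  then have "\<bar>deriv F z\<bar> * (\<bar>a - b\<bar> * \<bar>a - c\<bar>) \<le> exp (M * (\<bar>a - b\<bar> + \<bar>a - c\<bar>)) * \<bar>deriv F w\<bar> * (\<bar>a - b\<bar> * \<bar>a - c\<bar>)"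
    by (rule mult_right_mono) simp
  then show ?thesis unfolding z(3) w(3) by (simp add: mult_ac)
qed

text \<open>The domains of finitely many local extensions cover \<open>K\<close>. A Lebesgue number
  of this cover is a common radius \<open>d\<close>, and the sum of the Lipschitz constants is a
  common \<open>M\<close>.\<close>

lemma diff_1Lip_bounded_distortion:
  assumes K: "compact K" and f: "f \<in> diff_1Lip K"
  shows "\<exists>d>0. \<exists>M. bounded_distortion K f d M"
proof -
  have "\<forall>x\<in>K. \<exists>I F L. open I \<and> is_interval I \<and> x \<in> I \<and> C1_diffeo_on I F \<and>
           L-lipschitz_on I (\<lambda>t. ln \<bar>deriv F t\<bar>) \<and> (\<forall>y\<in>I \<inter> K. F y = f y)"
    using f unfolding diff_1Lip_def by blast
  then obtain I F L where I: "\<And>x. x \<in> K \<Longrightarrow> open (I x) \<and> is_interval (I x) \<and> x \<in> I x \<and> C1_diffeo_on (I x) (F x) \<and>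
           (L x)-lipschitz_on (I x) (\<lambda>t. ln \<bar>deriv (F x) t\<bar>) \<and> (\<forall>y\<in>I x \<inter> K. F x y = f y)"
    by metis
  have "K \<subseteq> (\<Union>x\<in>K. I x)" using I by blast
  then obtain T where T: "T \<subseteq> K" "finite T" "K \<subseteq> (\<Union>x\<in>T. I x)"
    using compactE_image[OF K, of K I] I by metis
  obtain d where d: "d > 0" "\<And>a. a \<in> K \<Longrightarrow> \<exists>G\<in>I ` T. ball a d \<subseteq> G"
    using Heine_Borel_lemma[OF K, of "I ` T"] T I by (metis (no_types, lifting) imageE subset_iff)
  define M where "M = (\<Sum>x\<in>T. L x)"
  have L0: "L x \<ge> 0" if "x \<in> T" for x using that T I lipschitz_on_nonneg by blast
  have "bounded_distortion K f d M" unfolding bounded_distortion_def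
  proof (intro ballI conjI)
    fix a assume a: "a \<in> K"
    then obtain x where x: "x \<in> T" "ball a d \<subseteq> I x" using d(2) by blast
    then have xK: "x \<in> K" using T by blast
    have C: "C1_diffeo_on (I x) (F x)" "open (I x)" "is_interval (I x)" using I xK by auto
    note D = C1_diffeo_onD[OF C]
    have eq: "F x y = f y" if "y \<in> K \<inter> ball a d" for y using I[OF xK] x(2) that by blast
    have "strict_mono_on (I x) (F x) \<or> strict_antimono_on (I x) (F x)"
      using injective_eq_monotone_map[OF C(3) D(4)] D(3) by blast
    then show "strict_mono_on (K \<inter> ball a d) f \<or> strict_antimono_on (K \<inter> ball a d) f"
    proof
      assume "strict_mono_on (I x) (F x)"
      then have "strict_mono_on (K \<inter> ball a d) (F x)" 
        by (rule monotone_on_subset) (use x in auto)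
      then show ?thesis using eq by (auto simp: monotone_on_def)
    next
      assume "strict_antimono_on (I x) (F x)"
      then have "strict_antimono_on (K \<inter> ball a d) (F x)" 
        by (rule monotone_on_subset) (use x in auto)
      then show ?thesis using eq by (auto simp: monotone_on_def)
    qed
    fix b c assume bc: "b \<in> K \<inter> ball a d" "c \<in> K \<inter> ball a d"
    have LM: "L x \<le> M" unfolding M_def by (rule member_le_sum[OF x(1) _ T(2)]) (use L0 in auto)
    have lip: "M-lipschitz_on (I x) (\<lambda>t. ln \<bar>deriv (F x) t\<bar>)"
      using lipschitz_on_le[OF _ LM] I[OF xK] by blast
    have "a \<in> K \<inter> ball a d" using a d(1) by simp
    then show "\<bar>f a - f b\<bar> * \<bar>a - c\<bar> \<le> exp (M * (\<bar>a - b\<bar> + \<bar>a - c\<bar>)) * (\<bar>f a - f c\<bar> * \<bar>a - b\<bar>)"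
      using C1_diffeo_on_distortion[OF C lip, of a b c] eq[of a] eq[of b] eq[of c] bc x(2) by (simp add: subset_iff)
  qed
  with d(1) show ?thesis by blast
qed

lemma bounded_distortion_between:
  assumes "bounded_distortion K f d M" "a \<in> K" "b \<in> K" "c \<in> K" "\<bar>a - c\<bar> < d" "min a c < b" "b < max a c"
  shows "min (f a) (f c) < f b \<and> f b < max (f a) (f c)"
proof -
  have mem: "a \<in> K \<inter> ball a d" "b \<in> K \<inter> ball a d" "c \<in> K \<inter> ball a d"
    using assms by (auto simp: dist_real_def min_def max_def split: if_splits)
  have "strict_mono_on (K \<inter> ball a d) f \<or> strict_antimono_on (K \<inter> ball a d) f"
    using assms(1,2) by (auto simp: bounded_distortion_def)
  moreover have "(a < b \<and> b < c) \<or> (c < b \<and> b < a)" using assms(6,7) by linarith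
  ultimately show ?thesis
    using mem unfolding monotone_on_def by (smt (verit))
qed

text \<open>Turns one-sided isolation into a gap. Because of \<open>w\<close> and \<open>w'\<close>,
  whichever side of \<open>p\<close> is empty nearby contains points of \<open>L\<close> farther
  out, and by compactness a nearest one.\<close>

lemma gap_exists:
  assumes L: "compact L" "p \<in> L" "w \<in> L" "w < p" "w' \<in> L" "p < w'"
    and e: "e > 0" "(\<forall>w\<in>L. \<not> (p < w \<and> w < p + e)) \<or> (\<forall>w\<in>L. \<not> (p - e < w \<and> w < p))"
  shows "\<exists>q. gap L p q"
  using e(2)
proof
  assume *: "\<forall>w\<in>L. \<not> (p < w \<and> w < p + e)"
  have "compact (L \<inter> {p + e..})" "L \<inter> {p + e..} \<noteq> {}"
    using L * by (auto intro!: compact_Int_closed simp: not_less)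
  then obtain q where "q \<in> L \<inter> {p + e..}" "\<forall>t\<in>L \<inter> {p + e..}. q \<le> t"
    using compact_attains_inf by metis
  then show ?thesis using * L e(1) by (intro exI[of _ q]) (force simp: gap_def)
next
  assume *: "\<forall>w\<in>L. \<not> (p - e < w \<and> w < p)"
  have "compact (L \<inter> {..p - e})" "L \<inter> {..p - e} \<noteq> {}"
    using L * by (auto intro!: compact_Int_closed simp: not_less)
  then obtain q where "q \<in> L \<inter> {..p - e}" "\<forall>t\<in>L \<inter> {..p - e}. q \<ge> t"
    using compact_attains_sup by metis
  then show ?thesis using * L e(1) by (intro exI[of _ q]) (force simp: gap_def)
qed

section \<open>Words and periodic actions on a compact set\<close>

text \<open>The head of the list acts first, so the points \<open>act (take i ws) x\<close> are the
  successive positions on a path starting at \<open>x\<close>.\<close>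

primrec act :: "('a \<Rightarrow> 'a) list \<Rightarrow> 'a \<Rightarrow> 'a" where
  "act [] x = x"
| "act (s # ws) x = act ws (s x)"

lemma act_append [simp]: "act (us @ ws) x = act ws (act us x)"
  by (induction us arbitrary: x) auto

text \<open>Group laws are required only up to agreement on \<open>K\<close>. The letters
  \<open>S\<close> have inverses in \<open>S\<close>, so that plain words reach every element.
  Smoothness enters only through \<open>distortion\<close>.\<close>

locale periodic_action =
  fixes K :: "real set" and H S :: "(real \<Rightarrow> real) set"
  assumes compact: "compact K"
    and maps: "f \<in> H \<Longrightarrow> x \<in> K \<Longrightarrow> f x \<in> K"
    and cont: "f \<in> H \<Longrightarrow> continuous_on K f"
    and distortion: "f \<in> H \<Longrightarrow> \<exists>d>0. \<exists>M. bounded_distortion K f d M"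
    and id_mem: "\<exists>e\<in>H. \<forall>x\<in>K. e x = x"
    and comp_mem: "f \<in> H \<Longrightarrow> g \<in> H \<Longrightarrow> \<exists>k\<in>H. \<forall>x\<in>K. k x = f (g x)"
    and inv_mem: "f \<in> H \<Longrightarrow> \<exists>g\<in>H. \<forall>x\<in>K. g (f x) = x \<and> f (g x) = x"
    and periodic: "f \<in> H \<Longrightarrow> \<exists>n>0. \<forall>x\<in>K. (f ^^ n) x = x"
    and finite_S: "finite S" and S_sub: "S \<subseteq> H"
    and inv_S: "s \<in> S \<Longrightarrow> \<exists>t\<in>S. \<forall>x\<in>K. t (s x) = x \<and> s (t x) = x"
    and word: "f \<in> H \<Longrightarrow> \<exists>ws\<in>lists S. \<forall>x\<in>K. f x = act ws x"
begin

definition orb :: "real \<Rightarrow> real set" where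
  "orb x = (\<lambda>f. f x) ` H"

lemma funpow_mem: "f \<in> H \<Longrightarrow> x \<in> K \<Longrightarrow> (f ^^ n) x \<in> K"
  by (induction n) (auto simp: maps)

lemma orb_sub: "x \<in> K \<Longrightarrow> orb x \<subseteq> K"
  using maps by (auto simp: orb_def)

lemma orb_self: "x \<in> K \<Longrightarrow> x \<in> orb x"
  unfolding orb_def using id_mem by (metis image_eqI)

lemma orb_trans: "x \<in> K \<Longrightarrow> y \<in> orb x \<Longrightarrow> z \<in> orb y \<Longrightarrow> z \<in> orb x"
  unfolding orb_def using comp_mem by (smt (verit, best) imageE image_eqI)

lemma orb_sym: "x \<in> K \<Longrightarrow> y \<in> orb x \<Longrightarrow> x \<in> orb y"
  unfolding orb_def using inv_mem by (smt (verit, best) imageE image_eqI)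

lemma orb_eq: "x \<in> K \<Longrightarrow> y \<in> orb x \<Longrightarrow> orb y = orb x"
  using orb_trans orb_sym orb_sub by (meson subsetI subset_antisym subset_iff)

lemma word_mem:
  assumes "ws \<in> lists S"
  shows "\<exists>f\<in>H. \<forall>x\<in>K. f x = act ws x"
  using assms
proof (induction ws rule: rev_induct)
  case Nil
  then show ?case using id_mem by simp
next
  case (snoc s ws)
  then obtain f where "f \<in> H" "\<forall>x\<in>K. f x = act ws x" by auto
  moreover obtain k where "k \<in> H" "\<forall>x\<in>K. k x = s (f x)"
    using comp_mem[of s f] snoc.prems S_sub \<open>f \<in> H\<close> by auto
  ultimately show ?case by (intro bexI[of _ k]) auto
qed

lemma word_maps: "ws \<in> lists S \<Longrightarrow> x \<in> K \<Longrightarrow> act ws x \<in> K"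
  using word_mem maps by metis

section \<open>Germs of group elements at a point\<close>

lemma eventually_near:
  assumes "f \<in> H" "p \<in> K" "e > 0"
  shows "eventually (\<lambda>y. y \<in> K \<longrightarrow> dist (f y) (f p) < e) (nhds p)"
proof -
  obtain d where "d > 0" "\<forall>y\<in>K. dist y p < d \<longrightarrow> dist (f y) (f p) < e"
    using cont[OF assms(1)] assms(2,3) unfolding continuous_on_iff by metis
  then show ?thesis by (auto simp: eventually_nhds_metric)
qed

lemma eventually_nhds_compose:
  assumes g: "g \<in> H" "p \<in> K" and ev: "eventually (\<lambda>y. y \<in> K \<longrightarrow> P y) (nhds (g p))"
  shows "eventually (\<lambda>y. y \<in> K \<longrightarrow> P (g y)) (nhds p)"
proof -
  obtain e where e: "e > 0" "\<And>y. dist y (g p) < e \<Longrightarrow> y \<in> K \<Longrightarrow> P y"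
    using ev by (auto simp: eventually_nhds_metric)
  show ?thesis
    by (rule eventually_mono[OF eventually_near[OF g e(1)]]) (use e maps g in auto)
qed

text \<open>If \<open>k y > y\<close>, then
  \<open>k\<^sup>n y > \<dots> > k y > y\<close> as long as the iterates stay in the domain of monotonicity.\<close>

lemma increasing_germ_trivial:
  assumes k: "k \<in> H" and p: "p \<in> K" "k p = p" and d: "d > 0"
    and mono: "strict_mono_on (K \<inter> ball p d) k"
  shows "eventually (\<lambda>y. y \<in> K \<longrightarrow> k y = y) (nhds p)"
proof -
  obtain n where n: "n > 0" "\<forall>x\<in>K. (k ^^ n) x = x" using periodic[OF k] by blast
  have ev: "eventually (\<lambda>y. y \<in> K \<longrightarrow> (k ^^ i) y \<in> ball p d) (nhds p)" for i
  proof (induction i)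
    case 0
    have "eventually (\<lambda>y. y \<in> ball p d) (nhds p)"
      using d by (intro eventually_nhds_in_open) auto
    then show ?case by (auto elim: eventually_mono)
  next
    case (Suc i)
    show ?case using eventually_nhds_compose[OF k p(1), of "\<lambda>y. (k ^^ i) y \<in> ball p d"] Suc p
      by (simp add: funpow_swap1)
  qed
  \<comment> \<open>Only the iterates up to the order \<open>n\<close> matter, so a single
    neighbourhood keeps them all in the domain of monotonicity.\<close>
  have "eventually (\<lambda>y. \<forall>i\<in>{..n}. y \<in> K \<longrightarrow> (k ^^ i) y \<in> ball p d) (nhds p)"
    by (rule eventually_ball_finite) (use ev in auto)
  then show ?thesis
  proof (rule eventually_mono, intro impI)
    fix y assume y: "\<forall>i\<in>{..n}. y \<in> K \<longrightarrow> (k ^^ i) y \<in> ball p d" "y \<in> K"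
    have in_ball: "(k ^^ i) y \<in> K \<inter> ball p d" if "i \<le> n" for i
      using y that funpow_mem[OF k] by auto
    have up: "(k ^^ i) y < (k ^^ Suc i) y" if "y < k y" "i < n" for i
      using that
    proof (induction i)
      case (Suc i)
      then show ?case using strict_mono_onD[OF mono in_ball[of i] in_ball[of "Suc i"]] by simp
    qed simp
    have down: "(k ^^ i) y > (k ^^ Suc i) y" if "y > k y" "i < n" for i
      using that
    proof (induction i)
      case (Suc i)
      then show ?case using strict_mono_onD[OF mono in_ball[of "Suc i"] in_ball[of i]] by simp
    qed simp
    have "(k ^^ i) y > y" if "y < k y" "0 < i" "i \<le> n" for i
      using that(2,3)
    proof (induction i rule: nat_induct_non_zero)
      case (Suc i)
      then show ?case using up[OF that(1), of i] by simp
    qed (use that in simp)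
    moreover have "(k ^^ i) y < y" if "y > k y" "0 < i" "i \<le> n" for i
      using that(2,3)
    proof (induction i rule: nat_induct_non_zero)
      case (Suc i)
      then show ?case using down[OF that(1), of i] by simp
    qed (use that in simp)
    ultimately show "k y = y" using n y(2) by (metis less_irrefl linorder_neqE_linordered_idom order_refl)
  qed
qed

definition rising :: "(real \<Rightarrow> real) \<Rightarrow> real \<Rightarrow> bool" where
  "rising f p \<longleftrightarrow> (\<exists>d>0. strict_mono_on (K \<inter> ball p d) f)"

lemma not_rising:
  assumes "f \<in> H" "p \<in> K" "\<not> rising f p"
  shows "\<exists>d>0. strict_antimono_on (K \<inter> ball p d) f"
  using distortion[OF assms(1)] assms(2,3) unfolding bounded_distortion_def rising_def by blast

text \<open>The quotient \<open>k\<close>, with \<open>g (k x) = h x\<close>, fixes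
  \<open>p\<close>. If it is increasing near \<open>p\<close>, its germ is trivial by periodicity;
  if it is decreasing, the equal orientations of \<open>g\<close> and \<open>h\<close> prevent it
  from moving nearby points.\<close>

lemma germ_determined:
  assumes g: "g \<in> H" and h: "h \<in> H" and p: "p \<in> K" and eq: "g p = h p"
    and ris: "rising g p = rising h p"
  shows "eventually (\<lambda>y. y \<in> K \<longrightarrow> g y = h y) (nhds p)"
proof -
  obtain g' where g': "g' \<in> H" "\<forall>x\<in>K. g' (g x) = x \<and> g (g' x) = x" using inv_mem[OF g] by blast
  obtain k where k: "k \<in> H" "\<forall>x\<in>K. k x = g' (h x)" using comp_mem[OF g'(1) h] by blast
  have gk: "g (k x) = h x" if "x \<in> K" for x using k g' maps[OF h that] that by simp
  have kp: "k p = p" using k g' p by (simp flip: eq)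
  have "eventually (\<lambda>y. y \<in> K \<longrightarrow> k y = y) (nhds p)"
  proof (cases "rising k p")
    case True
    then show ?thesis using increasing_germ_trivial[OF k(1) p kp] by (auto simp: rising_def)
  next
    case False
    obtain d1 where d1: "d1 > 0" "strict_antimono_on (K \<inter> ball p d1) k"
      using not_rising[OF k(1) p False] by blast
    obtain d2 where d2: "d2 > 0" "(strict_mono_on (K \<inter> ball p d2) g \<and> strict_mono_on (K \<inter> ball p d2) h) \<or>
      (strict_antimono_on (K \<inter> ball p d2) g \<and> strict_antimono_on (K \<inter> ball p d2) h)"
    proof (cases "rising g p")
      case True
      then obtain a b where ab: "a > 0" "b > 0" "strict_mono_on (K \<inter> ball p a) g" "strict_mono_on (K \<inter> ball p b) h"
        using ris by (auto simp: rising_def)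
      show thesis
        by (rule that[of "min a b"], use ab in simp, intro disjI1 conjI;
            rule monotone_on_subset[OF ab(3)] monotone_on_subset[OF ab(4)]; auto)
    next
      case False
      then obtain a b where ab: "a > 0" "b > 0" "strict_antimono_on (K \<inter> ball p a) g" "strict_antimono_on (K \<inter> ball p b) h"
        using ris not_rising g h p by metis
      show thesis
        by (rule that[of "min a b"], use ab in simp, intro disjI2 conjI;
            rule monotone_on_subset[OF ab(3)] monotone_on_subset[OF ab(4)]; auto)
    qed
    have "eventually (\<lambda>y. y \<in> ball p (min d1 d2)) (nhds p)"
      using d1 d2 by (intro eventually_nhds_in_open) auto
    with eventually_near[OF k(1) p d2(1)] show ?thesis
    proof eventually_elim
      case (elim y)
      show ?case
      proof (intro impI, rule ccontr)
        assume y: "y \<in> K" "k y \<noteq> y"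
        have ne: "y \<noteq> p" using y kp by auto
        have b: "p \<in> K \<inter> ball p d1" "y \<in> K \<inter> ball p d1" "p \<in> K \<inter> ball p d2" "y \<in> K \<inter> ball p d2"
           "k y \<in> K \<inter> ball p d2"
          using p y elim d1 d2 maps[OF k(1)] kp by (auto simp: dist_commute)
        \<comment> \<open>A decreasing germ fixing \<open>p\<close> exchanges the two sides of
          \<open>p\<close>. But \<open>g (k y) = h y\<close> with \<open>g\<close> and
          \<open>h\<close> of equal orientation forces \<open>k\<close> to preserve them, so no such
          \<open>y\<close> exists.\<close>
        have kk: "y < p \<longleftrightarrow> p < k y" 
          using ne d1(2) b(1,2) kp unfolding monotone_on_def by (metis linorder_neqE_linordered_idom order_less_asym)
        have "y < p \<longleftrightarrow> k y < p"
          using d2(2)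
        proof
          assume *: "strict_mono_on (K \<inter> ball p d2) g \<and> strict_mono_on (K \<inter> ball p d2) h"
          have "y < p \<longleftrightarrow> h y < h p" using * b(3,4) unfolding monotone_on_def by (metis less_asym less_irrefl linorder_neqE_linordered_idom)
          moreover have "k y < p \<longleftrightarrow> g (k y) < g p" using * b(3,5) unfolding monotone_on_def by (metis less_asym less_irrefl linorder_neqE_linordered_idom)
          ultimately show ?thesis using gk y eq by simp
        next
          assume *: "strict_antimono_on (K \<inter> ball p d2) g \<and> strict_antimono_on (K \<inter> ball p d2) h"
          have "y < p \<longleftrightarrow> h y > h p" using * b(3,4) unfolding monotone_on_def by (metis less_asym less_irrefl linorder_neqE_linordered_idom)
          moreover have "k y < p \<longleftrightarrow> g (k y) > g p" using * b(3,5) unfolding monotone_on_def by (metis less_asym less_irrefl linorder_neqE_linordered_idom)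
          ultimately show ?thesis using gk y eq by simp
        qed
        moreover have "k y \<noteq> p" using gk[OF y(1)] gk[OF p] d1(2) b(1,2) ne kp unfolding monotone_on_def
          by (metis less_irrefl linorder_neqE_linordered_idom)
        ultimately show False using kk by linarith
      qed
    qed
  qed
  then show ?thesis by eventually_elim (use gk in metis)
qed

section \<open>Consequences of finite orbits\<close>

text \<open>Value and orientation at \<open>p\<close> determine a germ, so a finite orbit leaves
  finitely many germs. The neighbourhood on which two elements agree still depends on the pair.
  Finite generation makes it uniform: it suffices that the finitely many relations
  \<open>s (r y) = t s r y\<close> hold on \<open>U\<close>, and induction on words does the
  rest.\<close>

lemma finite_orbit_local:
  assumes p: "p \<in> K" and fin: "finite (orb p)"
  shows "\<exists>U R. open U \<and> p \<in> U \<and> finite R \<and> R \<subseteq> H \<and> (\<forall>f\<in>H. \<exists>r\<in>R. \<forall>y\<in>U \<inter> K. f y = r y)"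
proof -
  define \<Phi> where "\<Phi> = (\<lambda>f. (f p, rising f p))"
  have "\<Phi> ` H \<subseteq> orb p \<times> UNIV" by (auto simp: \<Phi>_def orb_def)
  then have "finite (\<Phi> ` H)" using fin by (meson finite finite_SigmaI finite_subset)
  then obtain R where R: "R \<subseteq> H" "finite R" "\<Phi> ` H = \<Phi> ` R"
    by (metis finite_subset_image order_refl)
  have rep: "\<exists>r\<in>R. eventually (\<lambda>y. y \<in> K \<longrightarrow> f y = r y) (nhds p)" if f: "f \<in> H" for f
  proof -
    obtain r where r: "r \<in> R" "\<Phi> f = \<Phi> r" using R(3) f by (metis imageE imageI)
    then have "f p = r p" "rising f p = rising r p" by (auto simp: \<Phi>_def)
    then show ?thesis using r(1) R(1) germ_determined[OF f _ p] by blast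
  qed
  obtain e where e: "e \<in> H" "\<forall>x\<in>K. e x = x" using id_mem by blast
  obtain e' where e': "e' \<in> R" "eventually (\<lambda>y. y \<in> K \<longrightarrow> e y = e' y) (nhds p)" using rep[OF e(1)] by blast
  have "\<exists>r'\<in>R. eventually (\<lambda>y. y \<in> K \<longrightarrow> s (r y) = r' y) (nhds p)" if sr: "s \<in> S" "r \<in> R" for s r
  proof -
    obtain k where k: "k \<in> H" "\<forall>x\<in>K. k x = s (r x)" using comp_mem[of s r] sr S_sub R(1) by blast
    obtain r' where "r' \<in> R" "eventually (\<lambda>y. y \<in> K \<longrightarrow> k y = r' y) (nhds p)" using rep[OF k(1)] by blast
    then show ?thesis using k(2) by (intro bexI[of _ r']) (auto elim: eventually_mono)
  qed
  then obtain t where t: "\<And>s r. s \<in> S \<Longrightarrow> r \<in> R \<Longrightarrow> t s r \<in> R \<and> eventually (\<lambda>y. y \<in> K \<longrightarrow> s (r y) = t s r y) (nhds p)"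
    by metis
  have "eventually (\<lambda>y. \<forall>s\<in>S. \<forall>r\<in>R. y \<in> K \<longrightarrow> s (r y) = t s r y) (nhds p)"
    by (intro eventually_ball_finite finite_S R(2) ballI) (use t in auto)
  with e'(2) have "eventually (\<lambda>y. (y \<in> K \<longrightarrow> e y = e' y) \<and> (\<forall>s\<in>S. \<forall>r\<in>R. y \<in> K \<longrightarrow> s (r y) = t s r y)) (nhds p)"
    by eventually_elim auto
  then obtain U where U: "open U" "p \<in> U" "\<And>y. y \<in> U \<Longrightarrow> y \<in> K \<Longrightarrow> e y = e' y"
     "\<And>y s r. y \<in> U \<Longrightarrow> s \<in> S \<Longrightarrow> r \<in> R \<Longrightarrow> y \<in> K \<Longrightarrow> s (r y) = t s r y"
    unfolding eventually_nhds by blast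
  have "\<exists>r\<in>R. \<forall>y\<in>U \<inter> K. act ws y = r y" if "ws \<in> lists S" for ws
    using that
  proof (induction ws rule: rev_induct)
    case Nil
    then show ?case using U(3) e(2) e'(1) by (intro bexI[of _ e']) auto
  next
    case (snoc s ws)
    then obtain r where r: "r \<in> R" "\<forall>y\<in>U \<inter> K. act ws y = r y" by auto
    have "s \<in> S" using snoc by auto
    then show ?case using r U(4) t by (intro bexI[of _ "t s r"]) auto
  qed
  then have "\<exists>r\<in>R. \<forall>y\<in>U \<inter> K. f y = r y" if "f \<in> H" for f
    using word[OF that] by (metis IntE)
  then show ?thesis using U(1,2) R(1,2) by (intro exI[of _ U] exI[of _ R] conjI) simp_all
qed

text \<open>Finitely many of the local neighbourhoods cover \<open>K\<close>. The tuple
  \<open>\<Psi> f\<close> of local representatives determines \<open>f\<close> on \<open>K\<close>,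
  and there are finitely many such tuples.\<close>

lemma finite_if_finite_orbits:
  assumes fin: "\<And>p. p \<in> K \<Longrightarrow> finite (orb p)"
  shows "finite ((\<lambda>f. restrict f K) ` H)"
proof -
  obtain U R where UR: "\<And>p. p \<in> K \<Longrightarrow> open (U p) \<and> p \<in> U p \<and> finite (R p) \<and> (\<forall>f\<in>H. \<exists>r\<in>R p. \<forall>y\<in>U p \<inter> K. f y = r y)"
    using finite_orbit_local fin by metis
  have "K \<subseteq> (\<Union>p\<in>K. U p)" using UR by blast
  then obtain T where T: "T \<subseteq> K" "finite T" "K \<subseteq> (\<Union>p\<in>T. U p)"
    using compactE_image[OF compact, of K U] UR by metis
  define \<Psi> where "\<Psi> f = (\<lambda>p\<in>T. SOME r. r \<in> R p \<and> (\<forall>y\<in>U p \<inter> K. f y = r y))" for f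
  have \<Psi>: "\<Psi> f p \<in> R p \<and> (\<forall>y\<in>U p \<inter> K. f y = \<Psi> f p y)" if f: "f \<in> H" and p: "p \<in> T" for f p
  proof -
    have "p \<in> K" using p T by blast
    then have "\<exists>r. r \<in> R p \<and> (\<forall>y\<in>U p \<inter> K. f y = r y)" using UR f by blast
    from someI_ex[OF this] show ?thesis unfolding \<Psi>_def restrict_apply'[OF p] .
  qed
  have "finite (PiE T R)" using T UR by (intro finite_PiE) blast+
  moreover have "\<Psi> ` H \<subseteq> PiE T R" using \<Psi> by (auto simp: \<Psi>_def)
  ultimately have finV: "finite (\<Psi> ` H)" by (rule rev_finite_subset)
  have "restrict f K = restrict g K" if "f \<in> H" "g \<in> H" "\<Psi> f = \<Psi> g" for f g
  proof (rule restrict_ext)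
    fix y assume y: "y \<in> K"
    then obtain p where p: "p \<in> T" "y \<in> U p" using T(3) by blast
    then show "f y = g y" using \<Psi>[OF that(1) p(1)] \<Psi>[OF that(2) p(1)] that(3) y by (metis IntI)
  qed
  then have "restrict f K = restrict (inv_into H \<Psi> (\<Psi> f)) K" if "f \<in> H" for f
    using that by (metis f_inv_into_f imageI inv_into_into)
  then have "(\<lambda>f. restrict f K) ` H \<subseteq> (\<lambda>v. restrict (inv_into H \<Psi> v) K) ` (\<Psi> ` H)"
    by (auto simp del: restrict_apply)
  then show ?thesis using finV by (meson finite_imageI finite_subset)
qed

section \<open>Points with infinite orbit and a recurrent maximum\<close>

definition infinite_orbits :: "real set" where
  "infinite_orbits = {p\<in>K. infinite (orb p)}"

text \<open>The complement is relatively open in \<open>K\<close>: near a point with finite orbit,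
  each orbit consists of the values of the finitely many representatives in
  \<open>R\<close>.\<close>

lemma compact_infinite_orbits: "compact infinite_orbits"
proof -
  have "\<exists>U. open U \<and> p \<in> U \<and> U \<inter> infinite_orbits = {}" if p: "p \<in> K" "p \<notin> infinite_orbits" for p
  proof -
    obtain U R where U: "open U" "p \<in> U" "finite R" "\<forall>f\<in>H. \<exists>r\<in>R. \<forall>y\<in>U \<inter> K. f y = r y"
      using finite_orbit_local[OF p(1)] p by (auto simp: infinite_orbits_def)
    have "orb y \<subseteq> (\<lambda>r. r y) ` R" if "y \<in> U \<inter> K" for y
      using U(4) that by (fastforce simp: orb_def)
    then have "finite (orb y)" if "y \<in> U \<inter> K" for y
      using U(3) that by (meson finite_imageI finite_subset)
    with U(1,2) show ?thesis by (intro exI[of _ U]) (auto simp: infinite_orbits_def)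
  qed
  then obtain U where U: "\<And>p. p \<in> K - infinite_orbits \<Longrightarrow> open (U p) \<and> p \<in> U p \<and> U p \<inter> infinite_orbits = {}" by (metis DiffE)
  have "infinite_orbits = K \<inter> - (\<Union>p\<in>K - infinite_orbits. U p)"
    using U by (auto simp: infinite_orbits_def)
  also have "compact \<dots>" using U by (intro compact_Int_closed compact closed_Compl open_UN) auto
  finally show ?thesis .
qed

lemma inj: "f \<in> H \<Longrightarrow> x \<in> K \<Longrightarrow> y \<in> K \<Longrightarrow> f x = f y \<Longrightarrow> x = y"
  using inv_mem by metis

text \<open>\<open>y \<mapsto> sup (orb y)\<close> is lower semicontinuous, hence attains its minimum on the compact
  set of points with infinite orbit. On the orbit closure of a minimiser it is constant, which replaces
  minimality of the orbit closure.\<close>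

lemma recurrent_maximum:
  assumes "infinite_orbits \<noteq> {}"
  shows "\<exists>L x. L \<subseteq> infinite_orbits \<and> compact L \<and> (\<forall>f\<in>H. \<forall>y\<in>L. f y \<in> L) \<and> x \<in> L \<and> (\<forall>y\<in>L. y \<le> x) \<and>
    (\<forall>y\<in>L. x \<in> closure (orb y))"
proof -
  define m where "m y = Sup (orb y)" for y
  have wK: "y \<in> K" if "y \<in> infinite_orbits" for y using that by (simp add: infinite_orbits_def)
  obtain B where B: "\<And>x. x \<in> K \<Longrightarrow> \<bar>x\<bar> \<le> B" using compact_imp_bounded[OF compact] by (auto simp: bounded_iff)
  have bdd: "bdd_above (orb y)" if "y \<in> K" for y
    using orb_sub[OF that] B by (intro bdd_aboveI[of _ B]) force
  have m_ge: "f y \<le> m y" if "f \<in> H" "y \<in> K" for f y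
    unfolding m_def by (rule cSup_upper[OF _ bdd]) (use that in \<open>auto simp: orb_def\<close>)
  have bddm: "bdd_below (m ` infinite_orbits)"
  proof (rule bdd_belowI2[of _ "-B"])
    fix y assume "y \<in> infinite_orbits"
    then have "y \<in> K" by (rule wK)
    moreover obtain e where "e \<in> H" "\<forall>x\<in>K. e x = x" using id_mem by blast
    ultimately show "- B \<le> m y" using m_ge[of e y] B[of y] by force
  qed
  define c where "c = Inf (m ` infinite_orbits)"
  have c_le: "c \<le> m y" if "y \<in> infinite_orbits" for y
    unfolding c_def by (rule cInf_lower[OF _ bddm]) (use that in auto)
  have "\<exists>y\<in>infinite_orbits. m y < c + 1 / real (Suc n)" for n
    using cInf_lessD[of "m ` infinite_orbits" "c + 1 / real (Suc n)"] assms by (auto simp: c_def)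
  then obtain Y where Y: "\<And>n. Y n \<in> infinite_orbits" "\<And>n. m (Y n) < c + 1 / real (Suc n)" by metis
  obtain y0 r where y0: "y0 \<in> infinite_orbits" "strict_mono r" "(Y \<circ> r) \<longlonglongrightarrow> y0"
    using compact_infinite_orbits Y(1) unfolding compact_def by metis
  \<comment> \<open>Lower semicontinuity: \<open>f y0\<close> is a limit of values bounded by the
    orbit suprema along the minimising sequence, and these tend to \<open>c\<close>.\<close>
  have lim0: "f y0 \<le> c" if f: "f \<in> H" for f
  proof (rule LIMSEQ_le)
    show "(\<lambda>n. f ((Y \<circ> r) n)) \<longlonglongrightarrow> f y0"
      by (rule continuous_on_tendsto_compose[OF cont[OF f] y0(3) wK[OF y0(1)]])
        (use Y(1) wK in auto)
    have "(\<lambda>n. c + 1 / real (Suc n)) \<longlonglongrightarrow> c + 0"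
      by (intro tendsto_add tendsto_const LIMSEQ_Suc[OF lim_1_over_n])
    from LIMSEQ_subseq_LIMSEQ[OF this y0(2)]
    show "((\<lambda>n. c + 1 / real (Suc n)) \<circ> r) \<longlonglongrightarrow> c" by simp
    show "\<exists>N. \<forall>n\<ge>N. f ((Y \<circ> r) n) \<le> ((\<lambda>n. c + 1 / real (Suc n)) \<circ> r) n"
      using m_ge[OF f wK[OF Y(1)]] Y(2) by (metis comp_apply less_imp_le order_trans)
  qed
  have K0: "y0 \<in> K" using wK y0 by blast
  define L where "L = closure (orb y0)"
  have orbw: "orb y0 \<subseteq> infinite_orbits"
    using orb_sub[OF K0] orb_eq[OF K0] y0(1) by (auto simp: infinite_orbits_def)
  then have Lw: "L \<subseteq> infinite_orbits"
    unfolding L_def using compact_infinite_orbits by (meson closure_minimal compact_imp_closed)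
  have cL: "compact L" unfolding L_def
    using compact_infinite_orbits Lw by (metis L_def closed_Int_compact closed_closure inf.absorb_iff1)
  have LK: "y \<in> K" if "y \<in> L" for y using that Lw wK by blast
  have invL: "f y \<in> L" if f: "f \<in> H" and y: "y \<in> L" for f y
  proof -
    have "f ` closure (orb y0) \<subseteq> closure (orb y0)"
    proof (rule image_closure_subset)
      show "continuous_on (closure (orb y0)) f"
        by (rule continuous_on_subset[OF cont[OF f]]) (use LK L_def in auto)
      show "f ` orb y0 \<subseteq> closure (orb y0)"
      proof (rule image_subsetI)
        fix u assume u: "u \<in> orb y0"
        have "f u \<in> orb u" using f by (auto simp: orb_def)
        then have "f u \<in> orb y0" by (rule orb_trans[OF K0 u])
        then show "f u \<in> closure (orb y0)" using closure_subset by blast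
      qed
    qed simp
    then show ?thesis using y by (auto simp: L_def)
  qed
  have Lc: "y \<le> c" if "y \<in> L" for y
  proof -
    have "closure (orb y0) \<subseteq> {..c}" by (rule closure_minimal) (use lim0 in \<open>auto simp: orb_def\<close>)
    then show ?thesis using that by (auto simp: L_def)
  qed
  \<comment> \<open>The supremum of the orbit of \<open>y\<close> is at most \<open>c\<close>, as
    \<open>L\<close> is invariant and lies below \<open>c\<close>, and at least \<open>c\<close> by
    the choice of \<open>c\<close> as an infimum.\<close>
  have c_cl: "c \<in> closure (orb y)" if y: "y \<in> L" for y
  proof -
    have ne: "orb y \<noteq> {}" using orb_self[OF LK[OF y]] by blast
    have "m y \<le> c" unfolding m_def
      by (rule cSup_least[OF ne]) (use Lc invL y in \<open>auto simp: orb_def\<close>)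
    then have "m y = c" using c_le Lw y by force
    then show ?thesis using closure_contains_Sup[OF ne bdd[OF LK[OF y]]] by (simp add: m_def)
  qed
  have "y0 \<in> L" unfolding L_def using orb_self[OF K0] closure_subset by blast
  then have "c \<in> L" using c_cl by (simp add: L_def)
  then show ?thesis using Lw cL invL Lc c_cl
    by (intro exI[of _ L] exI[of _ c] conjI ballI) simp_all
qed

section \<open>Gaps along paths of the action\<close>

text \<open>Carries the one-sided isolation of the maximum of \<open>L\<close> to its whole orbit.
  The inverse \<open>g\<close> is continuous and monotone near \<open>f p\<close>, so points of
  \<open>L\<close> near \<open>f p\<close> on both sides would yield points near \<open>p\<close> on
  both sides. A decreasing \<open>g\<close> merely exchanges the sides.\<close>

lemma one_sided_image:
  assumes f: "f \<in> H" and L: "L \<subseteq> K" "\<forall>f\<in>H. \<forall>y\<in>L. f y \<in> L" and p: "p \<in> L"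
    and e: "e > 0" "(\<forall>w\<in>L. \<not> (p < w \<and> w < p + e)) \<or> (\<forall>w\<in>L. \<not> (p - e < w \<and> w < p))"
  shows "\<exists>e>0. (\<forall>w\<in>L. \<not> (f p < w \<and> w < f p + e)) \<or> (\<forall>w\<in>L. \<not> (f p - e < w \<and> w < f p))"
proof -
  obtain g where g: "g \<in> H" "\<forall>x\<in>K. g (f x) = x \<and> f (g x) = x" using inv_mem[OF f] by blast
  obtain d M where d: "d > 0" "bounded_distortion K g d M" using distortion[OF g(1)] by blast
  have fp: "f p \<in> L" "f p \<in> K" using L p f by auto
  have gfp: "g (f p) = p" using g p L by auto
  have "eventually (\<lambda>w. w \<in> K \<longrightarrow> dist (g w) (g (f p)) < e) (nhds (f p))"
    by (rule eventually_near[OF g(1) fp(2) e(1)])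
  then obtain r where r: "r > 0" "\<And>w. dist w (f p) < r \<Longrightarrow> w \<in> K \<Longrightarrow> dist (g w) p < e"
    unfolding eventually_nhds_metric gfp by blast
  define t where "t = min d r"
  have t: "t > 0" using d r by (simp add: t_def)
  have gw: "g w \<in> L" "\<bar>g w - p\<bar> < e" "w \<in> K \<inter> ball (f p) d" if "w \<in> L" "\<bar>w - f p\<bar> < t" for w
    using that r(2)[of w] L g(1) by (auto simp: t_def dist_real_def)
  have fpb: "f p \<in> K \<inter> ball (f p) d" using fp d by simp
  consider "strict_mono_on (K \<inter> ball (f p) d) g" | "strict_antimono_on (K \<inter> ball (f p) d) g"
    using d(2) fp(2) by (auto simp: bounded_distortion_def)
  then show ?thesis
  proof cases
    case 1
    have "g w < p" if "w \<in> L" "\<bar>w - f p\<bar> < t" "w < f p" for w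
      using strict_mono_onD[OF 1 gw(3)[OF that(1,2)] fpb that(3)] gfp by simp
    moreover have "g w > p" if "w \<in> L" "\<bar>w - f p\<bar> < t" "w > f p" for w
      using strict_mono_onD[OF 1 fpb gw(3)[OF that(1,2)] that(3)] gfp by simp
    ultimately show ?thesis using e(2) gw(1,2) t
      by (intro exI[of _ t] conjI) (smt (verit))+
  next
    case 2
    have "g w > p" if "w \<in> L" "\<bar>w - f p\<bar> < t" "w < f p" for w
      using monotone_onD[OF 2 gw(3)[OF that(1,2)] fpb that(3)] gfp by simp
    moreover have "g w < p" if "w \<in> L" "\<bar>w - f p\<bar> < t" "w > f p" for w
      using monotone_onD[OF 2 fpb gw(3)[OF that(1,2)] that(3)] gfp by simp
    ultimately show ?thesis using e(2) gw(1,2) t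
      by (intro exI[of _ t] conjI) (smt (verit))+
  qed
qed

lemma uniform_distortion: "\<exists>d>0. \<exists>M\<ge>0. \<forall>s\<in>S. bounded_distortion K s d M"
proof -
  have "\<exists>d>0. \<exists>M\<ge>0. \<forall>s\<in>T. bounded_distortion K s d M" if "finite T" "T \<subseteq> H" for T
    using that
  proof induction
    case empty
    then show ?case by (auto intro!: exI[of _ "1::real"])
  next
    case (insert s T)
    then obtain d M where d: "d > 0" "M \<ge> 0" "\<forall>s\<in>T. bounded_distortion K s d M" by auto
    obtain d' M' where d': "d' > 0" "bounded_distortion K s d' M'" using distortion insert by blast
    show ?case
      using d d' by (intro exI[of _ "min d d'"] conjI exI[of _ "max M M'"])
        (auto elim!: bounded_distortion_mono)
  qed
  then show ?thesis using finite_S S_sub by blast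
qed

lemma uniform_continuity:
  assumes "d > 0"
  shows "\<exists>e>0. e \<le> d \<and> (\<forall>s\<in>S. \<forall>x\<in>K. \<forall>y\<in>K. \<bar>x - y\<bar> < e \<longrightarrow> \<bar>s x - s y\<bar> < d)"
proof -
  have "\<exists>e>0. e \<le> d \<and> (\<forall>s\<in>T. \<forall>x\<in>K. \<forall>y\<in>K. \<bar>x - y\<bar> < e \<longrightarrow> \<bar>s x - s y\<bar> < d)"
    if "finite T" "T \<subseteq> H" for T
    using that
  proof induction
    case empty
    then show ?case using assms by (auto intro!: exI[of _ d])
  next
    case (insert s T)
    then obtain e where e: "e > 0" "e \<le> d" "\<forall>s\<in>T. \<forall>x\<in>K. \<forall>y\<in>K. \<bar>x - y\<bar> < e \<longrightarrow> \<bar>s x - s y\<bar> < d"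
      by auto
    have "uniformly_continuous_on K s"
      using compact_uniformly_continuous[OF cont compact] insert by blast
    then obtain e' where e': "e' > 0" "\<forall>x\<in>K. \<forall>y\<in>K. \<bar>x - y\<bar> < e' \<longrightarrow> \<bar>s x - s y\<bar> < d"
      using assms unfolding uniformly_continuous_on_def dist_real_def by metis
    show ?case
      using e e' by (intro exI[of _ "min e e'"] conjI) auto
  qed
  then show ?thesis using finite_S S_sub by blast
qed

text \<open>A point of \<open>L\<close> strictly between \<open>s p\<close> and \<open>s q\<close>
  would be sent by the inverse generator strictly between \<open>p\<close> and \<open>q\<close>.
  Smallness of the gap keeps its image within the scale \<open>d\<close> on which that inverse is
  monotone.\<close>

lemma gap_image:
  assumes L: "L \<subseteq> K" "\<forall>f\<in>H. \<forall>y\<in>L. f y \<in> L"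
    and tm: "\<And>s. s \<in> S \<Longrightarrow> bounded_distortion K s d M"
    and e: "\<forall>s\<in>S. \<forall>x\<in>K. \<forall>y\<in>K. \<bar>x - y\<bar> < e \<longrightarrow> \<bar>s x - s y\<bar> < d"
    and s: "s \<in> S" and gap: "gap L p q" and small: "\<bar>p - q\<bar> < e"
  shows "gap L (s p) (s q)"
proof -
  obtain t where t: "t \<in> S" "\<forall>x\<in>K. t (s x) = x \<and> s (t x) = x" using inv_S[OF s] by blast
  have pq: "p \<in> L" "q \<in> L" "p \<in> K" "q \<in> K" "p \<noteq> q" using gap L by (auto simp: gap_def)
  have sH: "s \<in> H" "t \<in> H" using s t S_sub by auto
  have sm: "\<bar>s p - s q\<bar> < d" using e s pq small by blast
  have "False" if w: "w \<in> L" "min (s p) (s q) < w" "w < max (s p) (s q)" for w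
  proof -
    have "min (t (s p)) (t (s q)) < t w \<and> t w < max (t (s p)) (t (s q))"
      by (rule bounded_distortion_between[OF tm[OF t(1)]]) (use w L sm maps sH pq in auto)
    then have "min p q < t w" "t w < max p q" using t(2) pq by auto
    then show False using gap L(2)[rule_format, OF sH(2) w(1)] by (auto simp: gap_def)
  qed
  then show ?thesis using pq bspec[OF L(2) sH(1)] inj[OF sH(1) pq(3,4)] unfolding gap_def by blast
qed

text \<open>Along a word whose orbit of \<open>p\<close> visits distinct endpoints of short gaps, the total
  length of the gaps is bounded, so that the distortion of the composition near \<open>p\<close> is bounded.\<close>

lemma path_control:
  assumes L: "L \<subseteq> K" "\<forall>f\<in>H. \<forall>y\<in>L. f y \<in> L"
    and ab: "L \<subseteq> {a..b}" "a \<le> b"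
    and tm: "\<And>s. s \<in> S \<Longrightarrow> bounded_distortion K s d M" and M: "M \<ge> 0"
    and e: "\<forall>s\<in>S. \<forall>x\<in>K. \<forall>y\<in>K. \<bar>x - y\<bar> < e \<longrightarrow> \<bar>s x - s y\<bar> < d" "e \<le> d"
    and gap: "gap L p q" and z: "z \<in> L" and ws: "ws \<in> lists S"
    and dist: "inj_on (\<lambda>i. act (take i ws) p) {..length ws}"
    and small: "\<And>i q. i \<le> length ws \<Longrightarrow> gap L (act (take i ws) p) q \<Longrightarrow> \<bar>act (take i ws) p - q\<bar> < e"
    and close: "exp (4 * M * (b - a)) * \<bar>z - p\<bar> \<le> \<bar>p - q\<bar>"
  shows "gap L (act ws p) (act ws q)" "\<bar>act ws z - act ws p\<bar> \<le> \<bar>act ws p - act ws q\<bar>"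
proof -
  let ?n = "length ws"
  define P Q Z where "P i = act (take i ws) p" and "Q i = act (take i ws) q" and "Z i = act (take i ws) z" for i
  have step: "P (Suc i) = (ws ! i) (P i)" "Q (Suc i) = (ws ! i) (Q i)" "Z (Suc i) = (ws ! i) (Z i)" if "i < ?n" for i
    using that by (auto simp: P_def Q_def Z_def take_Suc_conv_app_nth)
  have wsS: "ws ! i \<in> S" if "i < ?n" for i using ws that by auto
  have g: "gap L (P i) (Q i)" if "i \<le> ?n" for i
    using that
  proof (induction i)
    case 0
    then show ?case using gap by (simp add: P_def Q_def)
  next
    case (Suc i)
    then have "gap L (P i) (Q i)" by simp
    moreover have "\<bar>P i - Q i\<bar> < e" using small[of i "Q i"] Suc calculation by (simp add: P_def)
    ultimately have "gap L ((ws ! i) (P i)) ((ws ! i) (Q i))"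
      using gap_image[OF L tm e(1) wsS] Suc.prems by (simp add: Suc_le_eq)
    then show ?case using step Suc.prems by (simp add: Suc_le_eq)
  qed
  have sm: "\<bar>P i - Q i\<bar> < e" if "i \<le> ?n" for i using small[OF that] g[OF that] by (simp add: P_def)
  have PQK: "P i \<in> K" "Q i \<in> K" "P i \<noteq> Q i" if "i \<le> ?n" for i using g[OF that] L by (auto simp: gap_def)
  have ZK: "Z i \<in> K" for i using word_maps[of "take i ws" z] ws z L by (auto simp: Z_def dest: in_set_takeD)
  \<comment> \<open>Total length of the gaps met before time \<open>i\<close>. The endpoints are
    distinct, so it is at most \<open>2 * (b - a)\<close>, which explains the constant 4 in
    \<open>close\<close>.\<close>
  define \<sigma> where "\<sigma> i = (\<Sum>j<i. \<bar>P j - Q j\<bar>)" for i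
  have \<sigma>: "\<sigma> i \<le> 2 * (b - a)" if "i \<le> ?n" for i
    unfolding \<sigma>_def
  proof (rule sum_gap_lengths[OF ab])
    show "inj_on P {..<i}" unfolding P_def by (rule inj_on_subset[OF dist]) (use that in auto)
  qed (use g that in auto)
  have exp\<sigma>: "exp (2 * M * \<sigma> i) * \<bar>z - p\<bar> \<le> \<bar>p - q\<bar>" if "i \<le> ?n" for i
  proof -
    have "2 * M * \<sigma> i \<le> 4 * M * (b - a)"
      using mult_left_mono[OF \<sigma>[OF that], of "2 * M"] M by (simp add: algebra_simps)
    then have "exp (2 * M * \<sigma> i) * \<bar>z - p\<bar> \<le> exp (4 * M * (b - a)) * \<bar>z - p\<bar>"
      by (intro mult_right_mono) auto
    then show ?thesis using close by simp
  qed
  have pq: "\<bar>p - q\<bar> > 0" using gap by (simp add: gap_def)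
  \<comment> \<open>\<open>?A\<close> says that the ratio of \<open>\<bar>Z i - P i\<bar>\<close> to
    the gap length has grown by a factor of at most \<open>exp (2 * M * \<sigma> i)\<close>.
    \<open>?B\<close> follows from it through \<open>close\<close> and keeps \<open>Z i\<close> in
    the ball where the next generator has bounded distortion.\<close>
  have *: "\<bar>Z i - P i\<bar> * \<bar>p - q\<bar> \<le> exp (2 * M * \<sigma> i) * \<bar>z - p\<bar> * \<bar>P i - Q i\<bar>
      \<and> \<bar>Z i - P i\<bar> \<le> \<bar>P i - Q i\<bar>" (is "?A i \<and> ?B i") if "i \<le> ?n" for i
    using that
  proof (induction i)
    have AB: "?B i" if "?A i" "i \<le> ?n" for i
    proof -
      have "exp (2 * M * \<sigma> i) * \<bar>z - p\<bar> * \<bar>P i - Q i\<bar> \<le> \<bar>p - q\<bar> * \<bar>P i - Q i\<bar>"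
        by (rule mult_right_mono[OF exp\<sigma>[OF that(2)]]) simp
      with that(1) have "\<bar>Z i - P i\<bar> * \<bar>p - q\<bar> \<le> \<bar>P i - Q i\<bar> * \<bar>p - q\<bar>" by (simp add: mult.commute)
      then show ?thesis using pq by simp
    qed
    {
      case 0
      have "?A 0" by (simp add: P_def Q_def Z_def \<sigma>_def)
      with AB show ?case by simp
    next
      case (Suc i)
      then have IH: "?A i" "?B i" and i: "i < ?n" "i \<le> ?n" by auto
      let ?l = "\<bar>P i - Q i\<bar>" and ?r = "\<bar>Z i - P i\<bar>"
      let ?l' = "\<bar>P (Suc i) - Q (Suc i)\<bar>" and ?r' = "\<bar>Z (Suc i) - P (Suc i)\<bar>"
      have l: "?l > 0" using PQK[OF i(2)] by simp
      have "?r' * ?l \<le> exp (M * (?r + ?l)) * (?l' * ?r)"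
      proof -
        have "Z i \<in> K \<inter> ball (P i) d" "Q i \<in> K \<inter> ball (P i) d"
          using ZK PQK i(2) sm[OF i(2)] IH(2) e(2) by (auto simp: dist_real_def abs_minus_commute)
        then show ?thesis
          using tm[OF wsS[OF i(1)]] PQK(1)[OF i(2)] unfolding bounded_distortion_def step[OF i(1)]
          by (metis abs_minus_commute)
      qed
      \<comment> \<open>By \<open>?B\<close> the exponent of this step is at most a multiple of the
        gap length, hence summable along the path.\<close>
      also have "\<dots> \<le> exp (M * (2 * ?l)) * (?l' * ?r)"
        using IH(2) M by (intro mult_right_mono) (auto intro!: mult_left_mono)
      finally have "?r' * ?l * \<bar>p - q\<bar> \<le> exp (M * (2 * ?l)) * (?l' * ?r) * \<bar>p - q\<bar>"
        using pq by (intro mult_right_mono) auto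
      also have "\<dots> = exp (M * (2 * ?l)) * ?l' * (?r * \<bar>p - q\<bar>)" by (simp add: mult_ac)
      also have "\<dots> \<le> exp (M * (2 * ?l)) * ?l' * (exp (2 * M * \<sigma> i) * \<bar>z - p\<bar> * ?l)"
        by (intro mult_left_mono IH(1)) auto
      also have "\<dots> = (exp (M * (2 * ?l)) * exp (2 * M * \<sigma> i)) * \<bar>z - p\<bar> * ?l' * ?l" by (simp add: mult_ac)
      also have "exp (M * (2 * ?l)) * exp (2 * M * \<sigma> i) = exp (2 * M * \<sigma> (Suc i))"
        unfolding exp_add[symmetric] by (simp add: \<sigma>_def algebra_simps)
      finally have "(?r' * \<bar>p - q\<bar>) * ?l \<le> (exp (2 * M * \<sigma> (Suc i)) * \<bar>z - p\<bar> * ?l') * ?l"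
        by (simp add: mult_ac)
      then have "?A (Suc i)" using l by simp
      with AB Suc.prems show ?case by blast
    }
  qed
  show "gap L (act ws p) (act ws q)" "\<bar>act ws z - act ws p\<bar> \<le> \<bar>act ws p - act ws q\<bar>"
    using g[of ?n] *[of ?n] by (simp_all add: P_def Q_def Z_def)
qed

section \<open>Geodesics in an infinite orbit\<close>

text \<open>Along a shortest word from \<open>x\<close> the word length of the visited points grows
  by one per step, so no point repeats and from length \<open>N\<close> on the finite set
  \<open>F\<close> is avoided. Removing the first \<open>N\<close> letters leaves paths that start
  in the finite set \<open>reach N\<close>; by pigeonhole infinitely many share their start.\<close>

lemma geodesics:
  assumes x: "x \<in> K" and inf: "infinite (orb x)" and F: "finite F"
  obtains x0 Y where "x0 \<in> orb x" "x0 \<notin> F" "Y \<subseteq> orb x" "infinite Y"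
    "\<And>y. y \<in> Y \<Longrightarrow> \<exists>ws\<in>lists S. act ws x0 = y \<and> inj_on (\<lambda>i. act (take i ws) x0) {..length ws} \<and>
      (\<forall>i\<le>length ws. act (take i ws) x0 \<notin> F)"
proof -
  define reach where "reach n = (\<lambda>ws. act ws x) ` {ws. set ws \<subseteq> S \<and> length ws = n}" for n
  define len where "len y = (LEAST n. y \<in> reach n)" for y
  have fin_reach: "finite (reach n)" for n
    unfolding reach_def by (intro finite_imageI finite_lists_length_eq finite_S)
  have reach_orb: "reach n \<subseteq> orb x" for n
  proof
    fix y assume "y \<in> reach n"
    then obtain ws where "ws \<in> lists S" "y = act ws x" by (auto simp: reach_def)
    moreover obtain f where "f \<in> H" "f x = act ws x" using word_mem[OF calculation(1)] x by blast
    ultimately show "y \<in> orb x" unfolding orb_def by (metis image_eqI)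
  qed
  have "\<exists>n. y \<in> reach n" if y: "y \<in> orb x" for y
  proof -
    obtain f where f: "f \<in> H" "y = f x" using y by (auto simp: orb_def)
    obtain ws where "ws \<in> lists S" "f x = act ws x" using word[OF f(1)] x by blast
    then show ?thesis unfolding reach_def f(2) by auto
  qed
  then have len: "y \<in> reach (len y)" if "y \<in> orb x" for y
    using that unfolding len_def by (metis LeastI)
  have len_le: "len y \<le> n" if "y \<in> reach n" for y n
    using that unfolding len_def by (rule Least_le)
  have "\<exists>ws. set ws \<subseteq> S \<and> length ws = len y \<and> act ws x = y" if "y \<in> orb x" for y
    using len[OF that] by (auto simp: reach_def)
  then obtain w where w: "\<And>y. y \<in> orb x \<Longrightarrow> set (w y) \<subseteq> S \<and> length (w y) = len y \<and> act (w y) x = y" by metis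
  have take_reach: "act (take i ws) x \<in> reach i" if "set ws \<subseteq> S" "i \<le> length ws" for ws i
    unfolding reach_def using that by (intro imageI) (auto dest: in_set_takeD)
  \<comment> \<open>A prefix of a shortest word is shortest: a shorter route \<open>us\<close> to
    the intermediate point would shorten the route to \<open>y\<close>.\<close>
  have len_take: "len (act (take i (w y)) x) = i" if y: "y \<in> orb x" and i: "i \<le> len y" for i y
  proof (rule antisym)
    let ?u = "act (take i (w y)) x"
    have u: "?u \<in> reach i" using take_reach w[OF y] i by simp
    then show "len ?u \<le> i" by (rule len_le)
    have "?u \<in> reach (len ?u)" using len u reach_orb by blast
    then obtain us where "us \<in> {ws. set ws \<subseteq> S \<and> length ws = len ?u}" "?u = act us x"
      unfolding reach_def by (rule imageE)
    then have us: "set us \<subseteq> S" "length us = len ?u" "act us x = ?u" by auto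
    have "y = act (us @ drop i (w y)) x"
      using w[OF y] us(3) by (metis act_append append_take_drop_id)
    moreover have "set (us @ drop i (w y)) \<subseteq> S" using us w[OF y] by (auto dest: in_set_dropD)
    ultimately have "y \<in> reach (length us + (len y - i))"
      using w[OF y] unfolding reach_def by (intro image_eqI[of _ _ "us @ drop i (w y)"]) auto
    then have "len y \<le> len ?u + (len y - i)" using len_le us(2) by metis
    then show "i \<le> len ?u" using i by simp
  qed
  \<comment> \<open>Points of \<open>F\<close> outside the orbit have an unspecified
    \<open>len\<close>; \<open>N\<close> exceeds that value too.\<close>
  obtain N where N: "\<And>p. p \<in> F \<Longrightarrow> len p < N"
    using finite_nat_set_iff_bounded[of "len ` F"] F by auto
  define V where "V = {y\<in>orb x. N \<le> len y}"
  have "orb x - V \<subseteq> (\<Union>n<N. reach n)" using len by (force simp: V_def)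
  then have "finite (orb x - V)" using fin_reach by (meson finite_UN finite_lessThan finite_subset)
  then have "infinite V" using inf by (metis Diff_infinite_finite finite_Diff2 finite_Diff)
  define h where "h y = act (take N (w y)) x" for y
  have hV: "h y \<in> reach N" if "y \<in> V" for y
    using that take_reach w unfolding h_def V_def by simp
  then have "finite (h ` V)" using fin_reach[of N] by (meson finite_subset image_subsetI)
  then obtain v where v: "v \<in> V" "infinite {y\<in>V. h y = h v}"
    using pigeonhole_infinite[OF \<open>infinite V\<close>] by blast
  have lh: "len (h v) = N" using v(1) len_take by (simp add: h_def V_def)
  show thesis
  proof (rule that)
    show "h v \<in> orb x" using hV[OF v(1)] reach_orb by blast
    show "{y\<in>V. h y = h v} \<subseteq> orb x" by (auto simp: V_def)
    show "infinite {y\<in>V. h y = h v}" by fact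
    show "h v \<notin> F" using N lh by force
    fix y assume y: "y \<in> {y\<in>V. h y = h v}"
    then have yo: "y \<in> orb x" "N \<le> len y" "h y = h v" by (auto simp: V_def)
    let ?ws = "drop N (w y)"
    have tk: "act (take i ?ws) (h v) = act (take (N + i) (w y)) x" for i
      using yo(3) by (simp add: h_def take_add)
    have lw: "length ?ws = len y - N" using w[OF yo(1)] by simp
    have lt: "len (act (take i ?ws) (h v)) = N + i" if "i \<le> length ?ws" for i
      unfolding tk by (rule len_take[OF yo(1)]) (use that lw yo(2) in simp)
    show "\<exists>ws\<in>lists S. act ws (h v) = y \<and> inj_on (\<lambda>i. act (take i ws) (h v)) {..length ws} \<and>
      (\<forall>i\<le>length ws. act (take i ws) (h v) \<notin> F)"
    proof (intro bexI[of _ ?ws] conjI allI impI)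
      show "act ?ws (h v) = y"
        using tk[of "length ?ws"] lw yo(2) w[OF yo(1)] by simp
      show "inj_on (\<lambda>i. act (take i ?ws) (h v)) {..length ?ws}"
        by (rule inj_onI) (metis lt add_left_cancel atMost_iff)
      show "act (take i ?ws) (h v) \<notin> F" if "i \<le> length ?ws" for i
        using lt[OF that] N by force
      show "?ws \<in> lists S" using w[OF yo(1)] by (auto dest: in_set_dropD)
    qed
  qed
qed

section \<open>The contraction excluding infinite orbits\<close>

lemma infinite_orbits_empty: "infinite_orbits = {}"
proof (rule ccontr)
  assume "infinite_orbits \<noteq> {}"
  then obtain L x where Lw: "L \<subseteq> infinite_orbits" and cL: "compact L" and inv: "\<forall>f\<in>H. \<forall>y\<in>L. f y \<in> L"
    and x: "x \<in> L" and x_max: "\<And>y. y \<in> L \<Longrightarrow> y \<le> x" and x_cl: "\<And>y. y \<in> L \<Longrightarrow> x \<in> closure (orb y)"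
    using recurrent_maximum by metis
  have LK: "L \<subseteq> K" using Lw by (auto simp: infinite_orbits_def)
  have xK: "x \<in> K" "infinite (orb x)" using x Lw by (auto simp: infinite_orbits_def)
  have orbL: "orb x \<subseteq> L" using inv x by (auto simp: orb_def)
  \<comment> \<open>Orbits in \<open>L\<close> come arbitrarily close to \<open>x\<close>; a
    continuous \<open>g\<close> with \<open>p = g x\<close> transfers this to
    \<open>p\<close>.\<close>
  have recur: "\<exists>f\<in>H. \<bar>f y - p\<bar> < \<epsilon>" if p: "p \<in> orb x" and y: "y \<in> L" and \<epsilon>: "\<epsilon> > 0" for p y \<epsilon>
  proof -
    obtain g where g: "g \<in> H" "p = g x" using p by (auto simp: orb_def)
    obtain \<eta> where \<eta>: "\<eta> > 0" "\<And>u. dist u x < \<eta> \<Longrightarrow> u \<in> K \<Longrightarrow> dist (g u) (g x) < \<epsilon>"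
      using eventually_near[OF g(1) xK(1) \<epsilon>] unfolding eventually_nhds_metric by blast
    obtain u where "u \<in> orb y" "dist u x < \<eta>"
      using x_cl[OF y] \<eta>(1) unfolding closure_approachable by blast
    then obtain f where f: "f \<in> H" "dist (f y) x < \<eta>" by (auto simp: orb_def)
    obtain k where k: "k \<in> H" "\<forall>x\<in>K. k x = g (f x)" using comp_mem[OF g(1) f(1)] by blast
    have "dist (g (f y)) (g x) < \<epsilon>" using \<eta>(2) f maps y LK by blast
    then show ?thesis using k y LK g(2) by (intro bexI[of _ k]) (auto simp: dist_real_def)
  qed
  obtain d M where d: "d > 0" and M: "M \<ge> 0" and tm: "\<And>s. s \<in> S \<Longrightarrow> bounded_distortion K s d M"
    using uniform_distortion by blast
  obtain e where e: "e > 0" "e \<le> d"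
    "\<forall>s\<in>S. \<forall>x\<in>K. \<forall>y\<in>K. \<bar>x - y\<bar> < e \<longrightarrow> \<bar>s x - s y\<bar> < d"
    using uniform_continuity[OF d] by metis
  obtain a where a: "a \<in> L" "\<And>y. y \<in> L \<Longrightarrow> a \<le> y"
    using compact_attains_inf[OF cL] x by blast
  have Lab: "L \<subseteq> {a..x}" and ax: "a \<le> x" using a x x_max by auto
  have bL: "bounded L" using cL by (rule compact_imp_bounded)
  \<comment> \<open>Off the first set every gap met along the path is shorter than \<open>e\<close>.
    Off \<open>a\<close> and \<open>x\<close> the start lies strictly between points of
    \<open>L\<close>, as \<open>gap_exists\<close> demands.\<close>
  define F where "F = {p. \<exists>q. gap L p q \<and> e \<le> \<bar>p - q\<bar>} \<union> {a, x}"
  have "finite F" using finite_long_gaps[OF bL e(1)] by (simp add: F_def)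
  then obtain x0 Y where x0: "x0 \<in> orb x" "x0 \<notin> F" and Y: "Y \<subseteq> orb x" "infinite Y"
    and path: "\<And>y. y \<in> Y \<Longrightarrow> \<exists>ws\<in>lists S. act ws x0 = y \<and>
      inj_on (\<lambda>i. act (take i ws) x0) {..length ws} \<and> (\<forall>i\<le>length ws. act (take i ws) x0 \<notin> F)"
    by (rule geodesics[OF xK]) (rule that; assumption)
  have x0L: "x0 \<in> L" "x0 \<in> K" using x0 orbL LK by auto
  obtain q where q: "gap L x0 q"
  proof -
    obtain f where f: "f \<in> H" "x0 = f x" using x0 by (auto simp: orb_def)
    \<comment> \<open>Nothing of \<open>L\<close> lies to the right of its maximum; the radius 1 is
      arbitrary.\<close>
    have right: "(\<forall>w\<in>L. \<not> (x < w \<and> w < x + 1)) \<or> (\<forall>w\<in>L. \<not> (x - 1 < w \<and> w < x))" using x_max by force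
    obtain r where r: "r > 0"
      "(\<forall>w\<in>L. \<not> (x0 < w \<and> w < x0 + r)) \<or> (\<forall>w\<in>L. \<not> (x0 - r < w \<and> w < x0))"
      using one_sided_image[OF f(1) LK inv x zero_less_one right] f(2) by blast
    have "a < x0" "x0 < x" using x0(2) a(2) x_max x0L by (force simp: F_def)+
    then show thesis using gap_exists[OF cL x0L(1) a(1) _ x _ r] that by blast
  qed
  \<comment> \<open>\<open>C\<close> is the distortion constant of \<open>path_control\<close>, and
    within \<open>\<rho>\<close> of \<open>x0\<close> its closeness hypothesis holds, whatever the
    word.\<close>
  define C where "C = exp (4 * M * (x - a))"
  define \<rho> where "\<rho> = \<bar>x0 - q\<bar> / C"
  have C: "C > 0" by (simp add: C_def)
  have \<rho>: "\<rho> > 0" using q C by (simp add: \<rho>_def gap_def)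
  have YL: "Y \<subseteq> L" using Y orbL by blast
  obtain l where l: "l \<in> L" "l islimpt Y"
    using Heine_Borel_imp_Bolzano_Weierstrass[OF cL Y(2) YL] by blast
  have lK: "l \<in> K" using l LK by blast
  have inf_ball: "infinite (Y \<inter> ball l \<epsilon>)" if "\<epsilon> > 0" for \<epsilon>
    using l(2) that by (simp add: islimpt_eq_infinite_ball)
  have near: "\<exists>f\<in>H. \<exists>\<eta>>0. \<forall>u\<in>L. \<bar>u - l\<bar> < \<eta> \<longrightarrow> \<bar>f u - x0\<bar> < \<epsilon>" if \<epsilon>: "\<epsilon> > 0" for \<epsilon>
  proof -
    obtain f where f: "f \<in> H" "\<bar>f l - x0\<bar> < \<epsilon> / 2" using recur[OF x0(1) l(1), of "\<epsilon> / 2"] \<epsilon> by auto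
    obtain \<eta> where \<eta>: "\<eta> > 0" "\<And>u. dist u l < \<eta> \<Longrightarrow> u \<in> K \<Longrightarrow> dist (f u) (f l) < \<epsilon> / 2"
      using eventually_near[OF f(1) lK, of "\<epsilon> / 2"] \<epsilon> unfolding eventually_nhds_metric by auto
    have "\<bar>f u - x0\<bar> < \<epsilon>" if "u \<in> L" "\<bar>u - l\<bar> < \<eta>" for u
    proof -
      have "dist (f u) (f l) < \<epsilon> / 2" using \<eta>(2) that LK by (auto simp: dist_real_def)
      then show ?thesis using f(2) unfolding dist_real_def by linarith
    qed
    then show ?thesis using f(1) \<eta>(1) by blast
  qed
  \<comment> \<open>Two distinct points near \<open>l\<close> are carried close to
    \<open>x0\<close>; by injectivity at most one of them lands on \<open>x0\<close>.\<close>
  obtain z where z: "z \<in> L" "z \<noteq> x0" "\<bar>z - x0\<bar> < \<rho>"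
  proof -
    obtain f \<eta> where f: "f \<in> H" "\<eta> > 0" "\<And>u. u \<in> L \<Longrightarrow> \<bar>u - l\<bar> < \<eta> \<Longrightarrow> \<bar>f u - x0\<bar> < \<rho>"
      using near[OF \<rho>] by blast
    obtain u where u: "u \<in> Y \<inter> ball l \<eta>" using inf_ball[OF f(2)] by (metis finite.emptyI equals0I)
    obtain v where v: "v \<in> Y \<inter> ball l \<eta>" "v \<noteq> u"
      using inf_ball[OF f(2)] by (metis finite.emptyI finite.insertI finite_subset insertI1 subsetI)
    have uv: "u \<in> L" "v \<in> L" "\<bar>u - l\<bar> < \<eta>" "\<bar>v - l\<bar> < \<eta>" using u v YL by (auto simp: dist_real_def)
    have "f u \<noteq> f v" using inj[OF f(1)] uv v(2) LK by blast
    then have "f u \<noteq> x0 \<or> f v \<noteq> x0" by auto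
    then show thesis using that f(3) uv inv[rule_format, OF f(1)] by blast
  qed
  define \<tau> where "\<tau> = \<bar>z - x0\<bar>"
  have \<tau>: "\<tau> > 0" using z by (simp add: \<tau>_def)
  obtain h \<eta> where h: "h \<in> H" "\<eta> > 0" "\<And>u. u \<in> L \<Longrightarrow> \<bar>u - l\<bar> < \<eta> \<Longrightarrow> \<bar>h u - x0\<bar> < \<tau>"
    using near[OF \<tau>] by blast
  \<comment> \<open>Infinitely many points of \<open>Y\<close> lie near \<open>l\<close>, but only
    finitely many points bound a gap of length at least \<open>\<eta> / 2\<close>.\<close>
  have "infinite (Y \<inter> ball l (\<eta> / 2) - {p. \<exists>q. gap L p q \<and> \<eta> / 2 \<le> \<bar>p - q\<bar>})"
    by (rule Diff_infinite_finite[OF finite_long_gaps[OF bL] inf_ball]) (use h(2) in auto)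
  then obtain y where y: "y \<in> Y" "\<bar>y - l\<bar> < \<eta> / 2" "\<And>q. gap L y q \<Longrightarrow> \<bar>y - q\<bar> < \<eta> / 2"
    by (smt (verit, best) DiffE IntD1 IntD2 abs_minus_commute dist_real_def ex_in_conv finite.emptyI mem_Collect_eq mem_ball)
  obtain ws where ws: "ws \<in> lists S" "act ws x0 = y" "inj_on (\<lambda>i. act (take i ws) x0) {..length ws}"
      "\<And>i. i \<le> length ws \<Longrightarrow> act (take i ws) x0 \<notin> F"
    using path[OF y(1)] by metis
  obtain g where g: "g \<in> H" "\<forall>x\<in>K. g x = act ws x" using word_mem[OF ws(1)] by blast
  obtain k where k: "k \<in> H" "\<forall>x\<in>K. k x = h (g x)" using comp_mem[OF h(1) g(1)] by blast
  \<comment> \<open>The path to \<open>y\<close> maps the points of \<open>L\<close> within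
    \<open>\<rho>\<close> of \<open>x0\<close> to points no farther from \<open>y\<close> than the
    length of a short gap, hence within \<open>\<eta>\<close> of \<open>l\<close>; from there
    \<open>h\<close> leads to within \<open>\<tau>\<close> of \<open>x0\<close>.\<close>
  have contr: "\<bar>k u - x0\<bar> < \<tau>" if u: "u \<in> L" "\<bar>u - x0\<bar> < \<rho>" for u
  proof -
    have "C * \<bar>u - x0\<bar> \<le> \<bar>x0 - q\<bar>" using u(2) C by (simp add: \<rho>_def field_simps)
    then have cl: "exp (4 * M * (x - a)) * \<bar>u - x0\<bar> \<le> \<bar>x0 - q\<bar>" by (simp add: C_def)
    have sm: "\<bar>act (take i ws) x0 - q\<bar> < e" if "i \<le> length ws" "gap L (act (take i ws) x0) q" for i q
      using ws(4)[OF that(1)] that(2) by (force simp: F_def)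
    note pc = path_control[OF LK inv Lab ax tm M e(3) e(2) q u(1) ws(1) ws(3) sm cl]
    have "\<bar>act ws u - y\<bar> < \<eta> / 2" using pc y(3) ws(2) by force
    moreover have "g u = act ws u" using g(2) u(1) LK by blast
    ultimately have "\<bar>g u - l\<bar> < \<eta>" using y(2) by argo
    then show ?thesis using h(3)[OF inv[rule_format, OF g(1) u(1)]] k u LK by auto
  qed
  have it: "(k ^^ i) z \<in> L \<and> \<bar>(k ^^ i) z - x0\<bar> < \<rho>" for i
  proof (induction i)
    case (Suc i)
    then show ?case using contr[of "(k ^^ i) z"] inv[rule_format, OF k(1)] z(3) by (simp add: \<tau>_def)
  qed (use z in auto)
  \<comment> \<open>All iterates of \<open>z\<close> from the first on are strictly closer to
    \<open>x0\<close> than \<open>z\<close> itself, so none of them returns to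
    \<open>z\<close>.\<close>
  obtain n where n: "n > 0" "\<forall>x\<in>K. (k ^^ n) x = x" using periodic[OF k(1)] by blast
  then obtain m where "n = Suc m" using gr0_implies_Suc by blast
  then have "k ((k ^^ m) z) = z" using n z LK by auto
  then show False using contr[of "(k ^^ m) z"] it[of m] by (simp add: \<tau>_def)
qed

lemma finite_action: "finite ((\<lambda>f. restrict f K) ` H)"
  by (rule finite_if_finite_orbits) (use infinite_orbits_empty in \<open>auto simp: infinite_orbits_def\<close>)

end

section \<open>The diffeomorphism group as a periodic action\<close>

lemma carrier_diff_1Lip_group: "carrier (diff_1Lip_group K) = diff_1Lip K"
  by (simp add: diff_1Lip_group_def)

lemma one_diff_1Lip_group: "x \<in> K \<Longrightarrow> \<one>\<^bsub>diff_1Lip_group K\<^esub> x = x"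
  by (simp add: diff_1Lip_group_def BijGroup_def)

lemma mult_diff_1Lip_group:
  "f \<in> diff_1Lip K \<Longrightarrow> g \<in> diff_1Lip K \<Longrightarrow> x \<in> K \<Longrightarrow> (f \<otimes>\<^bsub>diff_1Lip_group K\<^esub> g) x = f (g x)"
  using diff_1Lip_subset_Bij[of K] by (auto simp: diff_1Lip_group_def BijGroup_def compose_def)

lemma diff_1Lip_maps: "f \<in> diff_1Lip K \<Longrightarrow> x \<in> K \<Longrightarrow> f x \<in> K"
  using diff_1Lip_subset_Bij Bij_imp_funcset by blast

lemma pow_diff_1Lip_group:
  assumes "f \<in> diff_1Lip K" "x \<in> K"
  shows "(f [^]\<^bsub>diff_1Lip_group K\<^esub> (n::nat)) x = (f ^^ n) x"
  using assms(2)
proof (induction n arbitrary: x)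
  case 0
  then show ?case by (simp add: one_diff_1Lip_group)
next
  case (Suc n)
  interpret group "diff_1Lip_group K" by (rule group_diff_1Lip_group)
  have "f [^]\<^bsub>diff_1Lip_group K\<^esub> n \<in> diff_1Lip K"
    using nat_pow_closed[of f n] assms(1) by (simp add: carrier_diff_1Lip_group)
  then show ?case
    using Suc diff_1Lip_maps[OF assms(1)] by (simp add: mult_diff_1Lip_group assms(1) funpow_swap1)
qed

lemma inv_diff_1Lip_group:
  assumes "f \<in> diff_1Lip K" "x \<in> K"
  shows "(inv\<^bsub>diff_1Lip_group K\<^esub> f) (f x) = x" "f ((inv\<^bsub>diff_1Lip_group K\<^esub> f) x) = x"
proof -
  interpret group "diff_1Lip_group K" by (rule group_diff_1Lip_group)
  have f: "f \<in> carrier (diff_1Lip_group K)" using assms by (simp add: carrier_diff_1Lip_group)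
  then have i: "inv\<^bsub>diff_1Lip_group K\<^esub> f \<in> diff_1Lip K" using inv_closed carrier_diff_1Lip_group by blast
  show "(inv\<^bsub>diff_1Lip_group K\<^esub> f) (f x) = x" "f ((inv\<^bsub>diff_1Lip_group K\<^esub> f) x) = x"
    using mult_diff_1Lip_group[OF i assms] mult_diff_1Lip_group[OF assms(1) i assms(2)]
      l_inv[OF f] r_inv[OF f] one_diff_1Lip_group[OF assms(2)] by simp_all
qed

text \<open>The inverses of the generators are adjoined because \<open>act\<close> reads plain
  letters only, whereas \<open>generate\<close> also allows inverses.\<close>

lemma periodic_action_diff_1Lip:
  fixes K :: "real set" and H T :: "(real \<Rightarrow> real) set"
  defines "G \<equiv> diff_1Lip_group K"
  assumes K: "compact K" and H: "subgroup H G" and T: "finite T" "T \<subseteq> H" "generate G T = H"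
    and per: "\<forall>h\<in>H. \<exists>n::nat. n > 0 \<and> h [^]\<^bsub>G\<^esub> n = \<one>\<^bsub>G\<^esub>"
  shows "periodic_action K H (T \<union> m_inv G ` T)"
proof -
  interpret group G unfolding G_def by (rule group_diff_1Lip_group)
  have sub: "H \<subseteq> diff_1Lip K"
    using subgroup.subset[OF H] by (simp add: G_def carrier_diff_1Lip_group)
  have TG: "T \<subseteq> carrier G" using T(2) subgroup.subset[OF H] by blast
  let ?S = "T \<union> m_inv G ` T"
  have inv_act: "\<forall>x\<in>K. (inv\<^bsub>G\<^esub> f) (f x) = x \<and> f ((inv\<^bsub>G\<^esub> f) x) = x" if "f \<in> H" for f
    using inv_diff_1Lip_group[of f K] that sub by (auto simp: G_def)
  have mult: "(f \<otimes>\<^bsub>G\<^esub> g) x = f (g x)" if "f \<in> H" "g \<in> H" "x \<in> K" for f g x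
    using that sub mult_diff_1Lip_group[of f K g x] by (auto simp: G_def)
  have word: "\<exists>ws\<in>lists ?S. \<forall>x\<in>K. h x = act ws x" if "h \<in> generate G T" for h
    using that
  proof induction
    case one
    show ?case by (rule bexI[of _ "[]"]) (auto simp: G_def one_diff_1Lip_group)
  next
    case (incl h)
    then show ?case by (intro bexI[of _ "[h]"]) auto
  next
    case (inv h)
    then show ?case by (intro bexI[of _ "[inv\<^bsub>G\<^esub> h]"]) auto
  next
    case (eng h1 h2)
    then obtain us ws where w: "us \<in> lists ?S" "\<forall>x\<in>K. h1 x = act us x" "ws \<in> lists ?S" "\<forall>x\<in>K. h2 x = act ws x"
      by blast
    have "h1 \<in> H" "h2 \<in> H" using eng T(3) by auto
    \<comment> \<open>In a product the right factor acts first, while \<open>act\<close> starts at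
      the head of the list; hence the words are swapped.\<close>
    then have "\<forall>x\<in>K. (h1 \<otimes>\<^bsub>G\<^esub> h2) x = act (ws @ us) x"
      using w mult diff_1Lip_maps sub by (metis act_append subset_iff)
    then show ?case using w by (intro bexI[of _ "ws @ us"]) auto
  qed
  show ?thesis
  proof
    show "compact K" by fact
    show "f x \<in> K" if "f \<in> H" "x \<in> K" for f x using that sub diff_1Lip_maps by blast
    show "continuous_on K f" if "f \<in> H" for f
      using that sub by (auto simp: diff_1Lip_def homeomorphism_def)
    show "\<exists>d>0. \<exists>M. bounded_distortion K f d M" if "f \<in> H" for f
      using that sub diff_1Lip_bounded_distortion[OF K] by blast
    show "\<exists>e\<in>H. \<forall>x\<in>K. e x = x"
      using subgroup.one_closed[OF H] by (rule rev_bexI) (simp add: G_def one_diff_1Lip_group)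
    show "\<exists>k\<in>H. \<forall>x\<in>K. k x = f (g x)" if "f \<in> H" "g \<in> H" for f g
      using subgroup.m_closed[OF H that] mult that by (intro bexI[of _ "f \<otimes>\<^bsub>G\<^esub> g"]) auto
    show "\<exists>g\<in>H. \<forall>x\<in>K. g (f x) = x \<and> f (g x) = x" if "f \<in> H" for f
      using subgroup.m_inv_closed[OF H that] inv_act[OF that] by blast
    show "\<exists>n>0. \<forall>x\<in>K. (f ^^ n) x = x" if f: "f \<in> H" for f
    proof -
      obtain n :: nat where n: "n > 0" "f [^]\<^bsub>G\<^esub> n = \<one>\<^bsub>G\<^esub>" using per f by blast
      have "(f ^^ n) x = x" if "x \<in> K" for x
        using pow_diff_1Lip_group[of f K x n] f sub that n(2) one_diff_1Lip_group[OF that]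
        by (auto simp: G_def)
      with n(1) show ?thesis by blast
    qed
    show "finite ?S" using T by simp
    show "?S \<subseteq> H" using T(2) subgroup.m_inv_closed[OF H] by auto
    show "\<exists>t\<in>?S. \<forall>x\<in>K. t (s x) = x \<and> s (t x) = x" if "s \<in> ?S" for s
      using that
    proof
      assume "s \<in> T"
      then show ?thesis using inv_act[of s] T(2) by blast
    next
      assume "s \<in> m_inv G ` T"
      then obtain t where "t \<in> T" "s = inv\<^bsub>G\<^esub> t" by blast
      then show ?thesis using inv_act[of t] T(2) by blast
    qed
    show "\<exists>ws\<in>lists ?S. \<forall>x\<in>K. f x = act ws x" if "f \<in> H" for f
      using word that T(3) by blast
  qed
qed

theorem theorem1p7:
  fixes K :: "real set" and H :: "(real \<Rightarrow> real) set"
  assumes "Cantor_set K"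
    and "subgroup H (diff_1Lip_group K)"
    and "\<exists>S. finite S \<and> S \<subseteq> H \<and> generate (diff_1Lip_group K) S = H"
    and "\<forall>h\<in>H. \<exists>n::nat. n > 0 \<and> h [^]\<^bsub>diff_1Lip_group K\<^esub> n = \<one>\<^bsub>diff_1Lip_group K\<^esub>"
  shows "finite H"
proof -
  obtain T where T: "finite T" "T \<subseteq> H" "generate (diff_1Lip_group K) T = H" using assms(3) by blast
  have "compact K" using assms(1) by (simp add: Cantor_set_def)
  then interpret periodic_action K H "T \<union> m_inv (diff_1Lip_group K) ` T"
    by (rule periodic_action_diff_1Lip[OF _ assms(2) T assms(4)])
  \<comment> \<open>Elements are extensional, so counting restrictions to \<open>K\<close> counts
    the elements themselves.\<close>
  have "restrict f K = f" if "f \<in> H" for f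
    using that subgroup.subset[OF assms(2)]
    by (intro extensional_restrict) (auto simp: carrier_diff_1Lip_group diff_1Lip_def)
  then have "(\<lambda>f. restrict f K) ` H = H" by simp
  then show ?thesis using finite_action by simp
qed

end
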